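(* Let $(X_t,V_t)_{t\in[0,T]}$ be the confined Langevin dynamics in $\bar G\times\mathbb{R}^d$ described in the context, with time-marginal law $\mathcal{L}^{(X,V)}_t$ having density $\rho(t,x,v)$. Let $(s_\theta)_\theta$ be a parametric family of functions with $s_\theta\in C^1([0,T]\times\mathbb{R}^d\times\mathbb{R}^d;\mathbb{R}^d)$. Then the score matching loss function $$\mathrm{Loss}(\theta)=\frac1T\int_0^T\mathbb{E}\,\big|s_\theta(t,X_t,V_t)-\nabla_v\ln\rho(t,X_t,V_t)\big|^2\,\mathrm{d}t$$ is given by $$\mathrm{Loss}(\theta)=\mathbb{E}_{t\sim\mathcal{U}([0,T])}\,\mathbb{E}_{\mathcal{L}^{(X,V)}_t}\Big(|s_\theta(t,X_t,V_t)|^2+2\,\mathrm{div}_v\big(s_\theta(t,X_t,V_t)\big)\Big)+C,$$ where $C>0$ is a constant (independent of $\theta$).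
   Context: $G\subset\mathbb{R}^d$ is a bounded open set with boundary $\partial G$ of class $C^{4,\epsilon}$, and $n(x)$ is the outward unit normal at $x\in\partial G$. $T>0$ is fixed, $\mathcal{U}([0,T])$ is the uniform distribution on $[0,T]$, $\langle a\cdot b\rangle$ is the Euclidean inner product, and $\mathrm{div}_v$, $\nabla_v$ denote divergence and gradient in the velocity variable $v\in\mathbb{R}^d$. The confined Langevin dynamics is the càdlàg-in-velocity process $(X_t,V_t)$ with $(X_0,V_0)\in G\times\mathbb{R}^d$ (random, distributed according to a given initial law) solving $$X_t=X_0+\int_0^tV_s\,\mathrm{d}s,$$ $$V_t=V_0+\int_0^tb(s,X_s)\,\mathrm{d}s-\int_0^t\gamma_sV_s\,\mathrm{d}s+\int_0^t\sqrt{2\gamma_s}\,\mathrm{d}W_s-2\sum_{0<s\le t}\langle n(X_s)\cdot V_{s^-}\rangle\,n(X_s)\,I_{\partial G}(X_s),$$ where $W$ is a $d$-dimensional Brownian motion, $b:[0,T]\times\bar G\to\mathbb{R}^d$ is the drift, $\gamma:[0,T]\to(0,\infty)$, $I_{\partial G}$ is the indicator function of $\partial G$, and $V_{s^-}$ is the left limit. Thus the velocity is specularly reflected whenever the position hits $\partial G$. For each $t$, $\rho(t,\cdot,\cdot)$ denotes the density on $\bar G\times\mathbb{R}^d$ of the law $\mathcal{L}^{(X,V)}_t$ of $(X_t,V_t)$. It satisfies the Fokker–Planck equation $$\partial_t\rho=-\langle v\cdot\nabla_x\rho\rangle-\langle b(t,x)\cdot\nabla_v\rho\rangle+\gamma_t\nabla_v\cdot(v\rho)+\gamma_t\Delta_v\rho$$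 with the specular boundary condition $\rho(t,x,v)=\rho(t,x,v-2\langle n(x)\cdot v\rangle n(x))$ for $x\in\partial G$, $\langle n(x)\cdot v\rangle>0$. *)

theory Defs
  imports "HOL-Probability.Probability"
begin

subsection \<open>Differential operators\<close>

definition grad :: "('a::euclidean_space \<Rightarrow> real) \<Rightarrow> 'a \<Rightarrow> 'a" where
  "grad f x = (\<Sum>i\<in>Basis. frechet_derivative f (at x) i *\<^sub>R i)"

definition divg :: "('a::euclidean_space \<Rightarrow> 'a) \<Rightarrow> 'a \<Rightarrow> real" where
  "divg f x = (\<Sum>i\<in>Basis. frechet_derivative f (at x) i \<bullet> i)"

text \<open>Continuous differentiability on a set that need not be open; meant for sets such as
  \<^term>\<open>{0..T} \<times> UNIV\<close>, on which the derivative within the set is unique.\<close>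

definition C1_on :: "'a::real_normed_vector set \<Rightarrow> ('a \<Rightarrow> 'b::real_normed_vector) \<Rightarrow> bool" where
  "C1_on S f \<longleftrightarrow>
     (\<exists>D :: 'a \<Rightarrow> 'a \<Rightarrow>\<^sub>L 'b.
        (\<forall>z\<in>S. (f has_derivative blinfun_apply (D z)) (at z within S)) \<and> continuous_on S D)"

subsection \<open>Domains with boundary of class $C^{k,\epsilon}$\<close>

text \<open>Only used on open sets \<open>S\<close>.  The partial derivatives of order \<open>k\<close> are Hoelder continuous with
  exponent \<open>\<epsilon>\<close>; continuity of all derivatives up to order \<open>k\<close> follows.\<close>

primrec C_Holder :: "nat \<Rightarrow> real \<Rightarrow> 'a::euclidean_space set \<Rightarrow> ('a \<Rightarrow> real) \<Rightarrow> bool" where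
  "C_Holder 0 \<epsilon> S f \<longleftrightarrow> (\<exists>K. \<forall>x\<in>S. \<forall>y\<in>S. \<bar>f x - f y\<bar> \<le> K * dist x y powr \<epsilon>)"
| "C_Holder (Suc k) \<epsilon> S f \<longleftrightarrow>
     (\<forall>x\<in>S. f differentiable (at x)) \<and>
     (\<forall>i\<in>Basis. C_Holder k \<epsilon> S (\<lambda>x. frechet_derivative f (at x) i))"

text \<open>Near \<open>p\<close>, the set \<open>G\<close> lies strictly below the graph of \<open>\<phi>\<close> in the direction of the unit vector
  \<open>e\<close>.  The third condition says that \<open>\<phi>\<close> is a function of the $d-1$ coordinates orthogonal to \<open>e\<close>.\<close>

definition local_graph ::
  "'a::euclidean_space set \<Rightarrow> 'a \<Rightarrow> 'a \<Rightarrow> ('a \<Rightarrow> real) \<Rightarrow> real \<Rightarrow> bool" where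
  "local_graph G p e \<phi> r \<longleftrightarrow>
     0 < r \<and> norm e = 1 \<and> (\<forall>x c. \<phi> (x + c *\<^sub>R e) = \<phi> x) \<and>
     G \<inter> ball p r = {x \<in> ball p r. x \<bullet> e < \<phi> x}"

definition Holder_boundary :: "nat \<Rightarrow> real \<Rightarrow> 'a::euclidean_space set \<Rightarrow> bool" where
  "Holder_boundary k \<epsilon> G \<longleftrightarrow>
     (\<forall>p\<in>frontier G. \<exists>e \<phi> r. local_graph G p e \<phi> r \<and> C_Holder k \<epsilon> (ball p r) \<phi>)"

text \<open>\<open>G\<close> is locally the sublevel set $\{y \bullet e - \phi(y) < 0\}$, and $e - \nabla\phi(x) \neq 0$
  because $\nabla\phi(x)$ is orthogonal to \<open>e\<close>.\<close>

definition outward_unit_normal :: "'a::euclidean_space set \<Rightarrow> 'a \<Rightarrow> 'a \<Rightarrow> bool" where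
  "outward_unit_normal G x \<nu> \<longleftrightarrow>
     (\<exists>e \<phi> r. local_graph G x e \<phi> r \<and> \<phi> differentiable (at x) \<and> \<nu> = sgn (e - grad \<phi> x))"

subsection \<open>Brownian motion and Wiener integrals\<close>

text \<open>Time is indexed by \<^typ>\<open>real\<close>, but only times in \<^term>\<open>{0..T}\<close> matter; a filtration given there
  extends constantly to all real times.\<close>

definition filtration_of :: "'w measure \<Rightarrow> (real \<Rightarrow> 'w measure) \<Rightarrow> bool" where
  "filtration_of M F \<longleftrightarrow> filtration (space M) F \<and> (\<forall>t. subalgebra M (F t))"

definition brownian_motion ::
  "'w measure \<Rightarrow> (real \<Rightarrow> 'w measure) \<Rightarrow> real \<Rightarrow> (real \<Rightarrow> 'w \<Rightarrow> 'a::euclidean_space) \<Rightarrow> bool" where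
  "brownian_motion M F T W \<longleftrightarrow>
     (\<forall>t\<in>{0..T}. W t \<in> borel_measurable (F t)) \<and>
     (AE \<omega> in M. W 0 \<omega> = 0 \<and> continuous_on {0..T} (\<lambda>t. W t \<omega>)) \<and>
     (\<forall>s t. 0 \<le> s \<and> s < t \<and> t \<le> T \<longrightarrow>
        distributed M lborel (\<lambda>\<omega>. W t \<omega> - W s \<omega>)
          (\<lambda>x. ennreal (\<Prod>i\<in>Basis. normal_density 0 (sqrt (t - s)) (x \<bullet> i))) \<and>
        prob_space.indep_set M (sets (F s))
          {(\<lambda>\<omega>. W t \<omega> - W s \<omega>) -` A \<inter> space M | A. A \<in> sets borel})"

text \<open>Step functions $\sum_{k<n} c_k 1_{(\tau_k,\tau_{k+1}]}$ and their stochastic integrals over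
  $(0,t]$, for a fixed path \<open>w\<close>.\<close>

definition step_fun :: "(nat \<Rightarrow> real) \<Rightarrow> (nat \<Rightarrow> real) \<Rightarrow> nat \<Rightarrow> real \<Rightarrow> real" where
  "step_fun \<tau> c n r = (\<Sum>k<n. c k * indicator {\<tau> k<..\<tau> (Suc k)} r)"

definition step_integral ::
  "(nat \<Rightarrow> real) \<Rightarrow> (nat \<Rightarrow> real) \<Rightarrow> nat \<Rightarrow> (real \<Rightarrow> 'a::real_vector) \<Rightarrow> real \<Rightarrow> 'a" where
  "step_integral \<tau> c n w t = (\<Sum>k<n. c k *\<^sub>R (w (min (\<tau> (Suc k)) t) - w (min (\<tau> k) t)))"

text \<open>\<open>J\<close> is (a version with continuous paths of) the process $t \mapsto \int_0^t g(s)\,dW_s$ for a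
  deterministic $g \in L^2([0,T])$: the $L^2$-limit of the integrals of step functions converging to
  \<open>g\<close> in $L^2([0,T])$.  By the Ito isometry the limit does not depend on the approximating sequence.
  The nonnegative integrals are infinite, not \<open>0\<close>, where square integrability fails.\<close>

definition wiener_integral ::
  "'w measure \<Rightarrow> real \<Rightarrow> (real \<Rightarrow> 'w \<Rightarrow> 'a::euclidean_space) \<Rightarrow> (real \<Rightarrow> real) \<Rightarrow>
   (real \<Rightarrow> 'w \<Rightarrow> 'a) \<Rightarrow> bool" where
  "wiener_integral M T W g J \<longleftrightarrow>
     set_borel_measurable lborel {0..T} g \<and>
     (\<forall>t\<in>{0..T}. J t \<in> borel_measurable M) \<and>
     (AE \<omega> in M. continuous_on {0..T} (\<lambda>t. J t \<omega>)) \<and>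
     (\<exists>\<tau> c n.
        (\<forall>j. mono_on {..n j} (\<tau> j) \<and> \<tau> j ` {..n j} \<subseteq> {0..T}) \<and>
        (\<lambda>j. \<integral>\<^sup>+r\<in>{0..T}. ennreal ((g r - step_fun (\<tau> j) (c j) (n j) r)\<^sup>2) \<partial>lborel)
          \<longlonglongrightarrow> 0 \<and>
        (\<forall>t\<in>{0..T}.
          (\<lambda>j. \<integral>\<^sup>+\<omega>. ennreal ((norm (J t \<omega>
                 - step_integral (\<tau> j) (c j) (n j) (\<lambda>r. W r \<omega>) t))\<^sup>2) \<partial>M) \<longlonglongrightarrow> 0))"

subsection \<open>Confined Langevin dynamics\<close>

definition cadlag_on :: "real \<Rightarrow> (real \<Rightarrow> 'a::t2_space) \<Rightarrow> bool" where
  "cadlag_on T v \<longleftrightarrow>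
     (\<forall>t\<in>{0..<T}. (v \<longlongrightarrow> v t) (at_right t)) \<and>
     (\<forall>t\<in>{0<..T}. \<exists>l. (v \<longlongrightarrow> l) (at_left t))"

text \<open>The summand of the reflection term at time \<open>s\<close>.  Off the boundary it vanishes, whatever the
  value of \<open>n\<close> there.\<close>

definition reflection_jump ::
  "'a::euclidean_space set \<Rightarrow> ('a \<Rightarrow> 'a) \<Rightarrow> (real \<Rightarrow> 'a) \<Rightarrow> (real \<Rightarrow> 'a) \<Rightarrow> real \<Rightarrow> 'a" where
  "reflection_jump G n x v s =
     (indicator (frontier G) (x s) * (n (x s) \<bullet> Lim (at_left s) v)) *\<^sub>R n (x s)"

definition confined_langevin ::
  "'w measure \<Rightarrow> (real \<Rightarrow> 'w measure) \<Rightarrow> real \<Rightarrow> 'a::euclidean_space set \<Rightarrow> ('a \<Rightarrow> 'a) \<Rightarrow>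
   (real \<Rightarrow> 'a \<Rightarrow> 'a) \<Rightarrow> (real \<Rightarrow> real) \<Rightarrow> (real \<Rightarrow> 'w \<Rightarrow> 'a) \<Rightarrow>
   (real \<Rightarrow> 'w \<Rightarrow> 'a) \<Rightarrow> (real \<Rightarrow> 'w \<Rightarrow> 'a) \<Rightarrow> bool" where
  "confined_langevin M F T G n b \<gamma> W X V \<longleftrightarrow>
     filtration_of M F \<and> brownian_motion M F T W \<and>
     (\<forall>t\<in>{0..T}. 0 < \<gamma> t) \<and> set_integrable lborel {0..T} \<gamma> \<and>
     (\<forall>t\<in>{0..T}. X t \<in> borel_measurable (F t) \<and> V t \<in> borel_measurable (F t)) \<and>
     (AE \<omega> in M. X 0 \<omega> \<in> G \<and> (\<forall>t\<in>{0..T}. X t \<omega> \<in> closure G)) \<and>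
     (AE \<omega> in M. cadlag_on T (\<lambda>t. V t \<omega>)) \<and>
     (AE \<omega> in M. set_integrable lborel {0..T} (\<lambda>s. b s (X s \<omega>))) \<and>
     (AE \<omega> in M. reflection_jump G n (\<lambda>t. X t \<omega>) (\<lambda>t. V t \<omega>) summable_on {0<..T}) \<and>
     (AE \<omega> in M. \<forall>t\<in>{0..T}. X t \<omega> = X 0 \<omega> + (LINT s:{0..t}|lborel. V s \<omega>)) \<and>
     (\<exists>J. wiener_integral M T W (\<lambda>s. sqrt (2 * \<gamma> s)) J \<and>
        (AE \<omega> in M. \<forall>t\<in>{0..T}.
           V t \<omega> = V 0 \<omega> + (LINT s:{0..t}|lborel. b s (X s \<omega>))
             - (LINT s:{0..t}|lborel. \<gamma> s *\<^sub>R V s \<omega>) + J t \<omega>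
             - 2 *\<^sub>R (\<Sum>\<^sub>\<infinity>s\<in>{0<..t}. reflection_jump G n (\<lambda>t. X t \<omega>) (\<lambda>t. V t \<omega>) s)))"

text \<open>The law of \<open>(X\<^sub>t, V\<^sub>t)\<close> has density \<open>\<rho> t\<close> on $\bar G \times R^d$.  Time \<open>0\<close> is left out so that
  singular initial laws are covered.\<close>

definition has_marginal_densities ::
  "'w measure \<Rightarrow> real \<Rightarrow> 'a::euclidean_space set \<Rightarrow> (real \<Rightarrow> 'w \<Rightarrow> 'a) \<Rightarrow>
   (real \<Rightarrow> 'w \<Rightarrow> 'a) \<Rightarrow> (real \<Rightarrow> 'a \<Rightarrow> 'a \<Rightarrow> real) \<Rightarrow> bool" where
  "has_marginal_densities M T G X V \<rho> \<longleftrightarrow>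
     (\<forall>t\<in>{0<..T}.
        (\<forall>x\<in>closure G. \<forall>v. 0 \<le> \<rho> t x v) \<and>
        distributed M lborel (\<lambda>\<omega>. (X t \<omega>, V t \<omega>))
          (\<lambda>(x, v). ennreal (indicator (closure G) x * \<rho> t x v)))"

text \<open>\<open>\<rho>\<close> solves the Fokker--Planck equation with specular boundary condition in the classical sense:
  all derivatives in the equation exist, the equation holds pointwise, and \<open>\<rho>\<close> is continuous up to
  the boundary, which is what gives the boundary condition its meaning.\<close>

definition fokker_planck_specular ::
  "real \<Rightarrow> 'a::euclidean_space set \<Rightarrow> ('a \<Rightarrow> 'a) \<Rightarrow> (real \<Rightarrow> 'a \<Rightarrow> 'a) \<Rightarrow> (real \<Rightarrow> real) \<Rightarrow>
   (real \<Rightarrow> 'a \<Rightarrow> 'a \<Rightarrow> real) \<Rightarrow> bool" where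
  "fokker_planck_specular T G n b \<gamma> \<rho> \<longleftrightarrow>
     continuous_on ({0<..<T} \<times> closure G \<times> UNIV) (\<lambda>(t, x, v). \<rho> t x v) \<and>
     (\<forall>t\<in>{0<..<T}. \<forall>x\<in>G. \<forall>v.
        (\<lambda>\<tau>. \<rho> \<tau> x v) differentiable (at t) \<and>
        (\<lambda>y. \<rho> t y v) differentiable (at x) \<and>
        \<rho> t x differentiable (at v) \<and>
        grad (\<rho> t x) differentiable (at v) \<and>
        deriv (\<lambda>\<tau>. \<rho> \<tau> x v) t =
          - (v \<bullet> grad (\<lambda>y. \<rho> t y v) x) - b t x \<bullet> grad (\<rho> t x) v
          + \<gamma> t * divg (\<lambda>w. \<rho> t x w *\<^sub>R w) v + \<gamma> t * divg (grad (\<rho> t x)) v) \<and>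
     (\<forall>t\<in>{0<..<T}. \<forall>x\<in>frontier G. \<forall>v. 0 < n x \<bullet> v \<longrightarrow>
        \<rho> t x v = \<rho> t x (v - (2 * (n x \<bullet> v)) *\<^sub>R n x))"

subsection \<open>Score matching\<close>

text \<open>$\nabla_v \ln\rho(t,x,v)$\<close>

definition score :: "(real \<Rightarrow> 'a::euclidean_space \<Rightarrow> 'a \<Rightarrow> real) \<Rightarrow> real \<Rightarrow> 'a \<Rightarrow> 'a \<Rightarrow> 'a" where
  "score \<rho> t x v = grad (\<lambda>w. ln (\<rho> t x w)) v"

abbreviation uniform_time :: "real \<Rightarrow> real measure" where
  "uniform_time T \<equiv> uniform_measure lborel {0..T}"

definition marginal_law ::
  "'w measure \<Rightarrow> (real \<Rightarrow> 'w \<Rightarrow> 'a::euclidean_space) \<Rightarrow> (real \<Rightarrow> 'w \<Rightarrow> 'a) \<Rightarrow> real \<Rightarrow> ('a \<times> 'a) measure"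
where
  "marginal_law M X V t = distr M borel (\<lambda>\<omega>. (X t \<omega>, V t \<omega>))"

text \<open>The iterated expectation of \<open>f t\<close>, first over \<open>P t\<close> and then over $t \sim U([0,T])$, exists and
  is finite.\<close>

definition iterated_expectation_exists ::
  "real \<Rightarrow> (real \<Rightarrow> 'z measure) \<Rightarrow> (real \<Rightarrow> 'z \<Rightarrow> real) \<Rightarrow> bool" where
  "iterated_expectation_exists T P f \<longleftrightarrow>
     (AE t in uniform_time T. integrable (P t) (f t)) \<and>
     integrable (uniform_time T) (\<lambda>t. \<integral>z. f t z \<partial>P t)"

definition score_error ::
  "(real \<Rightarrow> 'a::euclidean_space \<Rightarrow> 'a \<Rightarrow> real) \<Rightarrow> (real \<Rightarrow> 'w \<Rightarrow> 'a) \<Rightarrow> (real \<Rightarrow> 'w \<Rightarrow> 'a) \<Rightarrow>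
   (real \<Rightarrow> 'a \<Rightarrow> 'a \<Rightarrow> 'a) \<Rightarrow> real \<Rightarrow> 'w \<Rightarrow> real" where
  "score_error \<rho> X V s t \<omega> = (norm (s t (X t \<omega>) (V t \<omega>) - score \<rho> t (X t \<omega>) (V t \<omega>)))\<^sup>2"

definition score_matching_loss ::
  "'w measure \<Rightarrow> real \<Rightarrow> (real \<Rightarrow> 'a::euclidean_space \<Rightarrow> 'a \<Rightarrow> real) \<Rightarrow>
   (real \<Rightarrow> 'w \<Rightarrow> 'a) \<Rightarrow> (real \<Rightarrow> 'w \<Rightarrow> 'a) \<Rightarrow> (real \<Rightarrow> 'a \<Rightarrow> 'a \<Rightarrow> 'a) \<Rightarrow> real" where
  "score_matching_loss M T \<rho> X V s =
     1 / T * (LINT t:{0..T}|lborel. (\<integral>\<omega>. score_error \<rho> X V s t \<omega> \<partial>M))"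

definition implicit_score_integrand ::
  "(real \<Rightarrow> 'a::euclidean_space \<Rightarrow> 'a \<Rightarrow> 'a) \<Rightarrow> real \<Rightarrow> 'a \<times> 'a \<Rightarrow> real" where
  "implicit_score_integrand s t = (\<lambda>(x, v). (norm (s t x v))\<^sup>2 + 2 * divg (s t x) v)"

end

theory Submission
  imports Defs
begin

text \<open>
  Write $f = \rho(t,x,\cdot)$ for fixed $t \in (0,T)$ and $x \in G$.  Expanding the square,
  $f|s - \nabla \ln f|^2 - f(|s|^2 + 2\,\mathrm{div}\,s) = |\nabla f|^2/f - 2\,\mathrm{div}(f s)$, so
  the claim for fixed $(t,x)$ amounts to $\int \mathrm{div}(f s)\,dv = 0$.  The left-hand side is
  integrable by hypothesis, and this alone gives enough decay to integrate by parts.  Fubini in $x$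
  (the boundary is a null set, being locally a graph) and integration in $t$ show that the two losses
  differ by the time-averaged Fisher information of $\rho$ in the velocity variable.  It is positive
  because no nonzero constant is integrable over the velocity space.
\<close>

subsection \<open>Gradients and integration by parts\<close>

text \<open>The obstacle is integrability: expanding the square and integrating term by term would
  need \<open>f |s|^2\<close>, \<open>grad f . s\<close> and \<open>|grad f|^2 / f\<close> to be
  integrable separately. What is available is the weighted error \<open>f |u|^2\<close>, where
  \<open>u = s - grad f / f\<close>, and the implicit integrand as a whole. Decay comes from
  splitting the flux as \<open>f s = f u + grad f\<close>. The first summand has norm at most
  \<open>(f + f |u|^2) / 2\<close>, which is integrable. The second has norm at most
  \<open>(f + |grad f|^2 / f) / 2\<close>, and here the last term is the Fisher integrand under
  study. The estimate is therefore circular, but the gradient of a cutoff of radius \<open>R\<close>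
  contributes a factor of order \<open>1 / R\<close>, small enough for the circular term to be
  absorbed.\<close>

lemma frechet_derivative_eq_grad:
  fixes f :: "'a::euclidean_space \<Rightarrow> real"
  assumes "f differentiable (at x)"
  shows "frechet_derivative f (at x) h = grad f x \<bullet> h"
proof -
  interpret linear "frechet_derivative f (at x)"
    using assms by (rule linear_frechet_derivative)
  have "frechet_derivative f (at x) h = frechet_derivative f (at x) (\<Sum>i\<in>Basis. (h \<bullet> i) *\<^sub>R i)"
    by (simp add: euclidean_representation)
  also have "\<dots> = grad f x \<bullet> h"
    unfolding grad_def inner_sum_left by (simp add: sum scale inner_commute mult.commute)
  finally show ?thesis .
qed

lemma has_derivative_grad:
  fixes f :: "'a::euclidean_space \<Rightarrow> real"
  assumes "f differentiable (at x)"
  shows "(f has_derivative (\<lambda>h. grad f x \<bullet> h)) (at x)"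
proof -
  have "frechet_derivative f (at x) = (\<lambda>h. grad f x \<bullet> h)"
    using assms by (simp add: fun_eq_iff frechet_derivative_eq_grad)
  then show ?thesis
    using assms by (metis frechet_derivative_works)
qed

lemma grad_unique:
  fixes f :: "'a::euclidean_space \<Rightarrow> real"
  assumes "(f has_derivative (\<lambda>h. g \<bullet> h)) (at x)"
  shows "grad f x = g"
  using frechet_derivative_at[OF assms, symmetric]
  by (simp add: grad_def euclidean_representation)

lemma grad_ln:
  fixes f :: "'a::euclidean_space \<Rightarrow> real"
  assumes "f differentiable (at x)" "0 < f x"
  shows "grad (\<lambda>y. ln (f y)) x = grad f x /\<^sub>R f x"
proof (rule grad_unique)
  show "((\<lambda>y. ln (f y)) has_derivative (\<lambda>h. (grad f x /\<^sub>R f x) \<bullet> h)) (at x)"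
    by (rule has_derivative_eq_rhs[OF has_derivative_ln[OF assms(2) has_derivative_grad[OF assms(1)]]])
       (simp add: fun_eq_iff field_simps)
qed

lemma grad_eq_0_at_min:
  fixes f :: "'a::euclidean_space \<Rightarrow> real"
  assumes "f differentiable (at x)" "\<And>y. f x \<le> f y"
  shows "grad f x = 0"
proof -
  have "(\<lambda>h. grad f x \<bullet> h) = (\<lambda>h. 0)"
    by (rule differential_zero_maxmin[of x UNIV f, OF _ _ has_derivative_grad[OF assms(1)]])
       (use assms(2) in auto)
  then have "grad f x \<bullet> grad f x = 0" by meson
  then show ?thesis by simp
qed

section \<open>Derivatives of compactly supported functions integrate to zero\<close>

lemma integrable_translation:
  fixes w :: "'a::euclidean_space \<Rightarrow> real"
  assumes "integrable lborel w"
  shows "integrable lborel (\<lambda>v. w (c + v))" "(\<integral>v. w (c + v) \<partial>lborel) = (\<integral>v. w v \<partial>lborel)"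
proof -
  have [measurable]: "w \<in> borel_measurable borel" using assms by auto
  have "integrable (distr lborel borel ((+) c)) w"
    using assms by (simp add: lborel_distr_plus)
  then show "integrable lborel (\<lambda>v. w (c + v))"
    by (subst (asm) integrable_distr_eq) auto
  have "(\<integral>v. w v \<partial>distr lborel borel ((+) c)) = (\<integral>v. w (c + v) \<partial>lborel)"
    by (rule integral_distr) auto
  then show "(\<integral>v. w (c + v) \<partial>lborel) = (\<integral>v. w v \<partial>lborel)"
    by (simp add: lborel_distr_plus)
qed

lemma integrable_continuous_compact_support:
  fixes w :: "'a::euclidean_space \<Rightarrow> real"
  assumes "continuous_on UNIV w" "\<And>v. v \<notin> cball 0 R \<Longrightarrow> w v = 0"
  shows "integrable lborel w"
proof -
  have "integrable lborel (\<lambda>v. indicator (cball 0 R) v *\<^sub>R w v)"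
    by (rule borel_integrable_compact) (auto intro: continuous_on_subset[OF assms(1)])
  moreover have "(\<lambda>v. indicator (cball 0 R) v *\<^sub>R w v) = w"
    using assms(2) by (auto simp: fun_eq_iff indicator_def)
  ultimately show ?thesis by simp
qed

lemma has_real_derivative_along_line:
  fixes w :: "'a::real_normed_vector \<Rightarrow> real"
  assumes "(w has_derivative D) (at (v + \<tau> *\<^sub>R e))"
  shows "((\<lambda>\<tau>. w (v + \<tau> *\<^sub>R e)) has_real_derivative D e) (at \<tau>)"
proof -
  have "((\<lambda>\<tau>. w (v + \<tau> *\<^sub>R e)) has_derivative (\<lambda>h. D (h *\<^sub>R e))) (at \<tau>)"
    by (rule has_derivative_compose[where f = "\<lambda>\<tau>. v + \<tau> *\<^sub>R e", OF _ assms])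
       (auto intro!: derivative_eq_intros)
  moreover have "D (h *\<^sub>R e) = D e * h" for h
    using linear_scale[OF has_derivative_linear[OF assms]] by simp
  ultimately show ?thesis by (simp add: has_field_derivative_def)
qed

lemma difference_quotient_LIMSEQ:
  fixes w :: "'a::real_normed_vector \<Rightarrow> real"
  assumes "(w has_derivative D) (at v)"
  shows "(\<lambda>k. (w (v + inverse (real (Suc k)) *\<^sub>R e) - w v) / inverse (real (Suc k))) \<longlonglongrightarrow> D e"
proof -
  have "((\<lambda>\<tau>. (w (v + \<tau> *\<^sub>R e) - w v) / \<tau>) \<longlongrightarrow> D e) (at 0)"
    using has_real_derivative_along_line[of w D v 0 e] assms by (simp add: DERIV_def)
  moreover have "filterlim (\<lambda>k. inverse (real (Suc k))) (at 0) sequentially"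
    unfolding filterlim_at using LIMSEQ_inverse_real_of_nat by auto
  ultimately show ?thesis by (rule filterlim_compose)
qed

text \<open>Translation invariance of Lebesgue measure makes every difference quotient of
  \<open>w\<close> in direction \<open>e\<close> integrate to 0, and dominated convergence carries
  this over to the derivative. No coordinate lines or iterated integrals are involved.\<close>

lemma integral_directional_derivative_eq_0:
  fixes w :: "'a::euclidean_space \<Rightarrow> real"
  assumes der: "\<And>v. (w has_derivative D v) (at v)"
    and cont: "continuous_on UNIV (\<lambda>v. D v e)"
    and supp: "\<And>v. v \<notin> cball 0 R \<Longrightarrow> w v = 0"
  shows "integrable lborel (\<lambda>v. D v e)" "(\<integral>v. D v e \<partial>lborel) = 0"
proof -
  have D0: "D v e = 0" if "v \<notin> cball 0 R" for v
  proof -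
    have "(w has_derivative (\<lambda>h. 0)) (at v)"
      by (rule has_derivative_transform_within_open[of "\<lambda>_. 0" _ _ _ "- cball 0 R"])
         (use that supp in auto)
    with der[of v] have "D v = (\<lambda>h. 0)" by (rule has_derivative_unique)
    then show ?thesis by simp
  qed
  show int: "integrable lborel (\<lambda>v. D v e)"
    using cont D0 by (rule integrable_continuous_compact_support)
  obtain K where K: "\<bar>D v e\<bar> \<le> K" for v
  proof -
    have "compact ((\<lambda>v. D v e) ` cball 0 R)"
      by (intro compact_continuous_image continuous_on_subset[OF cont]) auto
    then obtain B where B: "\<And>v. v \<in> cball 0 R \<Longrightarrow> norm (D v e) \<le> B"
      by (force dest: compact_imp_bounded simp: bounded_iff)
    have "\<bar>D v e\<bar> \<le> max B 0" for v
      using B[of v] D0[of v] by (cases "v \<in> cball 0 R") auto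
    then show ?thesis by (rule that)
  qed
  have contw: "continuous_on UNIV w"
    using der by (meson continuous_at_imp_continuous_on has_derivative_continuous)
  have intw: "integrable lborel w"
    using contw supp by (rule integrable_continuous_compact_support)
  define h where "h k = inverse (real (Suc k))" for k
  have h: "0 < h k" "h k \<le> 1" for k
    by (auto simp: h_def field_simps)
  define q where "q k v = (w (v + h k *\<^sub>R e) - w v) / h k" for k v
  have [measurable]: "w \<in> borel_measurable borel" using intw by auto
  have q0: "(\<integral>v. q k v \<partial>lborel) = 0" for k
    using integrable_translation[OF intw, of "h k *\<^sub>R e"] intw
    by (simp add: q_def add.commute)
  have "(\<lambda>k. \<integral>v. q k v \<partial>lborel) \<longlonglongrightarrow> (\<integral>v. D v e \<partial>lborel)"
  proof (rule integral_dominated_convergence)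
    show "(\<lambda>v. D v e) \<in> borel_measurable lborel" using int by simp
    show "q k \<in> borel_measurable lborel" for k unfolding q_def by measurable
    \<comment> \<open>The dominating function: step sizes are at most 1, so all quotients live in
      one ball, enlarged by \<open>norm e\<close>, and the mean value theorem bounds them by
      \<open>K\<close>.\<close>
    have "integrable lborel (\<lambda>v::'a. indicator (cball 0 (R + norm e)) v *\<^sub>R K)"
      by (rule borel_integrable_compact) auto
    then show "integrable lborel (\<lambda>v::'a. indicator (cball 0 (R + norm e)) v * K)" by simp
    show "AE v in lborel. (\<lambda>k. q k v) \<longlonglongrightarrow> D v e"
      unfolding q_def h_def using difference_quotient_LIMSEQ[OF der] by simp
    show "AE v in lborel. norm (q k v) \<le> indicator (cball 0 (R + norm e)) v * K" for k
    proof (rule AE_I2)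
      fix v :: 'a
      have "\<exists>z>0. z < h k \<and> w (v + h k *\<^sub>R e) - w (v + 0 *\<^sub>R e) = (h k - 0) * D (v + z *\<^sub>R e) e"
        by (rule MVT2[OF h(1)]) (rule has_real_derivative_along_line[OF der])
      then obtain z where "w (v + h k *\<^sub>R e) - w v = h k * D (v + z *\<^sub>R e) e" by auto
      then have "\<bar>q k v\<bar> \<le> K"
        using K[of "v + z *\<^sub>R e"] h[of k] by (simp add: q_def)
      moreover have "q k v = 0" if "v \<notin> cball 0 (R + norm e)"
      proof -
        have "norm v \<le> norm (v + h k *\<^sub>R e) + norm (h k *\<^sub>R e)"
          by (metis add_diff_cancel_right' norm_triangle_ineq4)
        moreover have "norm (h k *\<^sub>R e) \<le> norm e" using h[of k] by (simp add: mult_left_le_one_le)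
        ultimately have "R < norm (v + h k *\<^sub>R e)" "R < norm v"
          using that by auto (smt (verit) norm_ge_zero)
        then show ?thesis using supp by (simp add: q_def)
      qed
      ultimately show "norm (q k v) \<le> indicator (cball 0 (R + norm e)) v * K"
        by (auto simp: indicator_def)
    qed
  qed
  then show "(\<integral>v. D v e \<partial>lborel) = 0"
    by (simp add: q0 LIMSEQ_const_iff)
qed

subsection \<open>Implicit score matching in the velocity variable\<close>

lemma has_real_derivative_max_0_power2:
  "((\<lambda>y::real. (max 0 y)\<^sup>2) has_real_derivative 2 * max 0 y) (at y)"
proof -
  consider "y < 0" | "y = 0" | "0 < y" by linarith
  then show ?thesis
  proof cases
    case 1
    have "((\<lambda>y::real. (max 0 y)\<^sup>2) has_real_derivative 0) (at y)"
      by (rule has_field_derivative_transform_within_open[of "\<lambda>_. 0" _ _ "{..<0}"])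
         (use 1 in auto)
    then show ?thesis using 1 by simp
  next
    case 2
    \<comment> \<open>Squaring removes the kink: at 0 the quotient is \<open>h\<close> or 0, so the
      one-sided slopes agree.\<close>
    have "((\<lambda>h::real. ((max 0 (0 + h))\<^sup>2 - (max 0 0)\<^sup>2) / h) \<longlongrightarrow> 0) (at 0)"
    proof (rule Lim_null_comparison)
      show "\<forall>\<^sub>F h::real in at 0. norm (((max 0 (0 + h))\<^sup>2 - (max 0 0)\<^sup>2) / h) \<le> \<bar>h\<bar>"
        by (rule always_eventually) (auto simp: max_def power2_eq_square)
      show "((\<lambda>h::real. \<bar>h\<bar>) \<longlongrightarrow> 0) (at 0)"
        by (rule tendsto_rabs_zero) (rule tendsto_ident_at)
    qed
    then show ?thesis using 2 by (simp add: DERIV_def)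
  next
    case 3
    have "((\<lambda>y::real. y\<^sup>2) has_real_derivative 2 * y) (at y)"
      by (auto intro!: derivative_eq_intros)
    then have "((\<lambda>y::real. (max 0 y)\<^sup>2) has_real_derivative 2 * y) (at y)"
      by (rule has_field_derivative_transform_within_open[where S = "{0<..}"]) (use 3 in auto)
    then show ?thesis using 3 by simp
  qed
qed

text \<open>Its square is $C^1$ with compact support, and the gradient of the square is at most \<open>4 / R\<close>
  times the square root.\<close>

definition cutoff :: "real \<Rightarrow> 'a::euclidean_space \<Rightarrow> real" where
  "cutoff R v = max 0 (1 - (norm v)\<^sup>2 / R\<^sup>2)"

lemma cutoff_nonneg: "0 \<le> cutoff R v"
  and cutoff_le_1: "cutoff R v \<le> 1"
  by (auto simp: cutoff_def)

lemma cutoff_eq_0: "0 < R \<Longrightarrow> R \<le> norm v \<Longrightarrow> cutoff R v = 0"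
  by (auto simp: cutoff_def max_def field_simps power2_le_iff_abs_le not_less)

lemma cutoff_mono: "0 < R \<Longrightarrow> R \<le> R' \<Longrightarrow> cutoff R v \<le> cutoff R' v"
  unfolding cutoff_def by (intro max.mono diff_mono divide_left_mono power_mono) auto

lemma continuous_on_cutoff: "continuous_on UNIV (cutoff R)"
  unfolding cutoff_def divide_inverse by (intro continuous_intros)

lemma cutoff_tendsto: "(\<lambda>k. cutoff (real k + c) v) \<longlonglongrightarrow> 1"
proof -
  have "(\<lambda>k. max 0 (1 - (norm v)\<^sup>2 / (real k + c)\<^sup>2)) \<longlonglongrightarrow> max 0 (1 - 0)"
    by (intro tendsto_max tendsto_diff tendsto_const) real_asymp
  then show ?thesis by (simp add: cutoff_def)
qed

lemma has_derivative_cutoff_power2: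
  "((\<lambda>v::'a::euclidean_space. (cutoff R v)\<^sup>2) has_derivative
      (\<lambda>h. (- (4 / R\<^sup>2) * cutoff R v) *\<^sub>R v \<bullet> h)) (at v)"
proof -
  have 1: "((\<lambda>v::'a. 1 - (norm v)\<^sup>2 / R\<^sup>2) has_derivative (\<lambda>h. - (2 / R\<^sup>2) * (v \<bullet> h))) (at v)"
    unfolding power2_norm_eq_inner divide_inverse
    by (auto intro!: derivative_eq_intros simp: inner_commute fun_eq_iff)
  have 2: "((\<lambda>y::real. (max 0 y)\<^sup>2) has_derivative
      (*) (2 * max 0 (1 - (norm v)\<^sup>2 / R\<^sup>2))) (at (1 - (norm v)\<^sup>2 / R\<^sup>2))"
    using has_real_derivative_max_0_power2 by (rule has_field_derivative_imp_has_derivative)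
  show ?thesis
    using has_derivative_compose[OF 1 2]
    unfolding cutoff_def by (rule has_derivative_eq_rhs) (simp add: fun_eq_iff)
qed

text \<open>On the support \<open>norm v / R\<close> is at most 1, which leaves
  \<open>4 / R\<close>. The surviving factor \<open>cutoff R v\<close> is essential later: its
  product with \<open>norm (grad f v)\<close> is controlled by \<open>f v\<close> and the localized,
  hence integrable, function \<open>(cutoff R v)^2 * q v\<close>.\<close>

lemma cutoff_gradient_bound:
  assumes "0 < R"
  shows "norm ((- (4 / R\<^sup>2) * cutoff R v) *\<^sub>R v) \<le> 4 / R * cutoff R v"
proof (cases "R \<le> norm v")
  case True
  then show ?thesis using assms by (simp add: cutoff_eq_0)
next
  case False
  have "norm ((- (4 / R\<^sup>2) * cutoff R v) *\<^sub>R v) = 4 / R * cutoff R v * (norm v / R)"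
    using cutoff_nonneg[of R v] by (simp add: abs_mult power2_eq_square)
  also have "\<dots> \<le> 4 / R * cutoff R v"
    using False assms cutoff_nonneg[of R v]
    by (intro mult_right_le_one_le) auto
  finally show ?thesis .
qed

text \<open>Here and below, division by \<open>f v = 0\<close> is harmless: \<open>f\<close> is minimal there, so its gradient
  vanishes as well.  Neither \<open>f |s|\<^sup>2\<close> nor \<open>f divg s\<close> nor the Fisher integrand \<open>q\<close> is assumed integrable.
  The identity \<open>q = h + 2 div (f s)\<close> with integrable \<open>h\<close> makes \<open>q\<close> locally integrable; testing it
  with squared cutoffs bounds the integral of \<open>q\<close> and makes the boundary term vanish as \<open>R\<close> grows.\<close>

lemma implicit_score_fibre:
  fixes f :: "'a::euclidean_space \<Rightarrow> real" and s :: "'a \<Rightarrow> 'a"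
  assumes f0: "\<And>v. 0 \<le> f v"
    and f_diff: "\<And>v. f differentiable (at v)"
    and f_cont: "continuous_on UNIV (grad f)"
    and s_diff: "\<And>v. s differentiable (at v)"
    and s_cont: "\<And>i. i \<in> Basis \<Longrightarrow> continuous_on UNIV (\<lambda>v. frechet_derivative s (at v) i)"
    and f_int: "integrable lborel f"
    and u_int: "integrable lborel (\<lambda>v. f v * (norm (s v - grad f v /\<^sub>R f v))\<^sup>2)"
    and d_int: "integrable lborel (\<lambda>v. f v * ((norm (s v))\<^sup>2 + 2 * divg s v))"
  shows "integrable lborel (\<lambda>v. (norm (grad f v))\<^sup>2 / f v)"
    and "(\<integral>v. f v * (norm (s v - grad f v /\<^sub>R f v))\<^sup>2 \<partial>lborel)
       - (\<integral>v. f v * ((norm (s v))\<^sup>2 + 2 * divg s v) \<partial>lborel)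
       = (\<integral>v. (norm (grad f v))\<^sup>2 / f v \<partial>lborel)"
proof -
  define u where "u v = s v - grad f v /\<^sub>R f v" for v
  define q where "q v = (norm (grad f v))\<^sup>2 / f v" for v
  define h where "h v = f v * (norm (u v))\<^sup>2 - f v * ((norm (s v))\<^sup>2 + 2 * divg s v)" for v
  \<comment> \<open>This is \<open>div (f s)\<close> expanded by the product rule. It is continuous,
    so it becomes integrable once multiplied by a cutoff.\<close>
  define p where "p v = grad f v \<bullet> s v + f v * divg s v" for v
  have q0: "0 \<le> q v" for v
    using f0 by (simp add: q_def)
  have g0: "grad f v = 0" if "f v = 0" for v
    using grad_eq_0_at_min[OF f_diff] f0 that by simp
  have contf: "continuous_on UNIV f"
    using f_diff by (simp add: continuous_at_imp_continuous_on differentiable_imp_continuous_within)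
  have conts: "continuous_on UNIV s"
    using s_diff by (simp add: continuous_at_imp_continuous_on differentiable_imp_continuous_within)
  have contd: "continuous_on UNIV (divg s)"
    unfolding divg_def by (intro continuous_intros s_cont)
  have contp: "continuous_on UNIV p"
    unfolding p_def by (intro continuous_intros f_cont conts contf contd)
  have h_int: "integrable lborel h"
    unfolding h_def u_def using u_int d_int by simp
  have q_eq: "q v = h v + 2 * p v" for v
  proof (cases "f v = 0")
    case True
    then show ?thesis by (simp add: q_def h_def p_def g0)
  next
    case False
    have "f v * (norm (u v))\<^sup>2 = f v * (norm (s v))\<^sup>2 - 2 * (grad f v \<bullet> s v) + q v"
      using False
      by (simp add: u_def q_def power2_norm_eq_inner inner_diff inner_commute field_simps)
    then show ?thesis by (simp add: h_def p_def algebra_simps)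
  qed
  have [measurable]: "f \<in> borel_measurable borel" "grad f \<in> borel_measurable borel"
    using contf f_cont by (auto intro: borel_measurable_continuous_onI)
  have q_meas [measurable]: "q \<in> borel_measurable borel"
    unfolding q_def by measurable
  have h_meas [measurable]: "h \<in> borel_measurable borel"
    using h_int by auto
  have cut_meas [measurable]: "cutoff R \<in> borel_measurable borel" for R :: real
    using continuous_on_cutoff by (rule borel_measurable_continuous_onI)

  define gc where "gc R v = (- (4 / R\<^sup>2) * cutoff R v) *\<^sub>R v" for R and v :: 'a
  \<comment> \<open>The part of the boundary estimate that does not depend on \<open>R\<close>. The
    factor 2 counts one \<open>f v\<close> from each of the estimates \<open>a\<close> and
    \<open>b\<close> below.\<close>
  define K where "K = (\<integral>v. 2 * f v + f v * (norm (u v))\<^sup>2 \<partial>lborel)"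
  have K_int: "integrable lborel (\<lambda>v. 2 * f v + f v * (norm (u v))\<^sup>2)"
    unfolding u_def using f_int u_int by simp

  \<comment> \<open>The second claim carries the unknown integral of
    \<open>(cutoff R v)^2 * q v\<close> on both sides. The first claim makes that integral finite,
    so that it can be absorbed for large \<open>R\<close>.\<close>
  have cut: "integrable lborel (\<lambda>v. (cutoff R v)\<^sup>2 * q v)"
      "\<bar>(\<integral>v. (cutoff R v)\<^sup>2 * q v \<partial>lborel) - (\<integral>v. (cutoff R v)\<^sup>2 * h v \<partial>lborel)\<bar>
         \<le> 4 / R * (K + (\<integral>v. (cutoff R v)\<^sup>2 * q v \<partial>lborel))"
      "integrable lborel (\<lambda>v. (cutoff R v)\<^sup>2 * h v)"
    if R: "0 < R" for R
  proof -
    have ch: "integrable lborel (\<lambda>v. (cutoff R v)\<^sup>2 * h v)"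
    proof (rule Bochner_Integration.integrable_bound[OF h_int])
      show "AE v in lborel. norm ((cutoff R v)\<^sup>2 * h v) \<le> norm (h v)"
        using cutoff_nonneg[of R] cutoff_le_1[of R]
        by (intro AE_I2) (auto simp: abs_mult intro!: mult_left_le_one_le power_le_one)
    qed measurable
    then show "integrable lborel (\<lambda>v. (cutoff R v)\<^sup>2 * h v)" .
    have cp: "integrable lborel (\<lambda>v. (cutoff R v)\<^sup>2 * p v)"
      by (rule integrable_continuous_compact_support[where R = R])
         (use R in \<open>auto intro!: continuous_intros continuous_on_cutoff contp simp: cutoff_eq_0\<close>)
    have cg: "integrable lborel (\<lambda>v. f v * (gc R v \<bullet> s v))"
      by (rule integrable_continuous_compact_support[where R = R])
         (use R in \<open>auto intro!: continuous_intros continuous_on_cutoff contf conts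
            simp: cutoff_eq_0 gc_def\<close>)
    have div0: "(\<integral>v. f v * (gc R v \<bullet> s v) + (cutoff R v)\<^sup>2 * p v \<partial>lborel) = 0"
    proof -
      \<comment> \<open>\<open>w i\<close> is the \<open>i\<close>-th component of the compactly
        supported field \<open>cutoff^2 f s\<close>, and \<open>D i v k\<close> its derivative at
        \<open>v\<close> in direction \<open>k\<close>. Summing \<open>D i v i\<close> over the
        basis gives the divergence.\<close>
      define w where "w i v = (cutoff R v)\<^sup>2 * f v * (s v \<bullet> i)" for i v
      define D where "D i v k = (gc R v \<bullet> k) * f v * (s v \<bullet> i) + (cutoff R v)\<^sup>2 * (grad f v \<bullet> k) * (s v \<bullet> i)
          + (cutoff R v)\<^sup>2 * f v * (frechet_derivative s (at v) k \<bullet> i)" for i v k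
      have D: "(w i has_derivative D i v) (at v)" for i v
      proof -
        have s: "(s has_derivative frechet_derivative s (at v)) (at v)"
          using s_diff frechet_derivative_works by blast
        note c = has_derivative_cutoff_power2[of R v, folded gc_def]
        note fc = has_derivative_mult[OF c has_derivative_grad[OF f_diff[of v]]]
        show ?thesis
          unfolding w_def
          by (rule has_derivative_eq_rhs[OF has_derivative_mult[OF fc has_derivative_inner_left[OF s]]])
             (simp add: fun_eq_iff D_def algebra_simps)
      qed
      have D0: "integrable lborel (\<lambda>v. D i v i)" "(\<integral>v. D i v i \<partial>lborel) = 0"
        if "i \<in> Basis" for i
      proof -
        have cont: "continuous_on UNIV (\<lambda>v. D i v i)"
          unfolding D_def gc_def
          by (intro continuous_intros continuous_on_cutoff contf conts f_cont s_cont that)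
        have supp: "w i v = 0" if "v \<notin> cball 0 R" for v
          using that R by (simp add: w_def cutoff_eq_0)
        show "integrable lborel (\<lambda>v. D i v i)" "(\<integral>v. D i v i \<partial>lborel) = 0"
          using integral_directional_derivative_eq_0[OF D cont supp] by auto
      qed
      have "f v * (gc R v \<bullet> s v) + (cutoff R v)\<^sup>2 * p v = (\<Sum>i\<in>Basis. D i v i)" for v
        unfolding p_def D_def divg_def
        by (subst (1 2) euclidean_inner)
           (simp add: sum.distrib sum_distrib_left sum_distrib_right algebra_simps)
      then have "(\<integral>v. f v * (gc R v \<bullet> s v) + (cutoff R v)\<^sup>2 * p v \<partial>lborel)
          = (\<Sum>i\<in>Basis. (\<integral>v. D i v i \<partial>lborel))"
        using D0(1) by simp
      then show ?thesis using D0(2) by simp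
    qed
    have cq_eq: "(cutoff R v)\<^sup>2 * q v = (cutoff R v)\<^sup>2 * h v + 2 * ((cutoff R v)\<^sup>2 * p v)" for v
      by (simp add: q_eq algebra_simps)
    show cq: "integrable lborel (\<lambda>v. (cutoff R v)\<^sup>2 * q v)"
      unfolding cq_eq using ch cp by simp
    have "(\<integral>v. (cutoff R v)\<^sup>2 * p v \<partial>lborel) = - (\<integral>v. f v * (gc R v \<bullet> s v) \<partial>lborel)"
      using div0 cp cg by simp
    then have "(\<integral>v. (cutoff R v)\<^sup>2 * q v \<partial>lborel) - (\<integral>v. (cutoff R v)\<^sup>2 * h v \<partial>lborel)
        = - 2 * (\<integral>v. f v * (gc R v \<bullet> s v) \<partial>lborel)"
      unfolding cq_eq using ch cp by simp
    then have "\<bar>(\<integral>v. (cutoff R v)\<^sup>2 * q v \<partial>lborel) - (\<integral>v. (cutoff R v)\<^sup>2 * h v \<partial>lborel)\<bar>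
        = \<bar>\<integral>v. 2 * (f v * (gc R v \<bullet> s v)) \<partial>lborel\<bar>"
      by simp
    also have "\<dots> \<le> (\<integral>v. 4 / R * ((2 * f v + f v * (norm (u v))\<^sup>2) + (cutoff R v)\<^sup>2 * q v) \<partial>lborel)"
    proof (rule integral_abs_bound_integral)
      show "integrable lborel (\<lambda>v. 2 * (f v * (gc R v \<bullet> s v)))" using cg by simp
      show "integrable lborel (\<lambda>v. 4 / R * ((2 * f v + f v * (norm (u v))\<^sup>2) + (cutoff R v)\<^sup>2 * q v))"
        by (rule integrable_mult_right[OF Bochner_Integration.integrable_add[OF K_int cq]])
      fix v :: 'a
      let ?m = "cutoff R v"
      have m: "0 \<le> ?m" "?m \<le> 1" by (rule cutoff_nonneg cutoff_le_1)+
      \<comment> \<open>The flux splits as \<open>f s = f u + grad f\<close>. The two parts are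
        estimated in \<open>a\<close> and \<open>b\<close>, both by the inequality between
        arithmetic and geometric mean.\<close>
      have fs: "f v * norm (s v) \<le> f v * norm (u v) + norm (grad f v)"
      proof (cases "f v = 0")
        case False
        have "norm (s v) \<le> norm (u v) + norm (grad f v /\<^sub>R f v)"
          unfolding u_def by (metis diff_add_cancel norm_triangle_ineq)
        then have "f v * norm (s v) \<le> f v * (norm (u v) + norm (grad f v /\<^sub>R f v))"
          using f0 by (rule mult_left_mono)
        also have "\<dots> = f v * norm (u v) + norm (grad f v)"
          using False f0[of v] by (simp add: field_simps)
        finally show ?thesis .
      qed simp
      have a: "2 * (?m * (f v * norm (u v))) \<le> f v + f v * (norm (u v))\<^sup>2"
      proof -
        have "2 * norm (u v) \<le> 1 + (norm (u v))\<^sup>2"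
          using zero_le_power2[of "norm (u v) - 1"] by (simp add: power2_eq_square algebra_simps)
        then have "f v * (2 * norm (u v)) \<le> f v * (1 + (norm (u v))\<^sup>2)"
          using f0 by (rule mult_left_mono)
        moreover have "?m * (f v * norm (u v)) \<le> f v * norm (u v)"
          using m f0 by (simp add: mult_left_le_one_le)
        ultimately show ?thesis by (simp add: algebra_simps)
      qed
      have b: "2 * (?m * norm (grad f v)) \<le> f v + ?m\<^sup>2 * q v"
      proof (cases "f v = 0")
        case True
        then show ?thesis by (simp add: g0 q_def)
      next
        case False
        then have f: "0 < f v" using f0[of v] by simp
        \<comment> \<open>Dividing the square by \<open>f v\<close> produces exactly
          \<open>q v\<close> in the last term, with the squared cutoff in front.\<close>
        have "0 \<le> (f v - ?m * norm (grad f v))\<^sup>2 / f v" using f by simp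
        also have "\<dots> = f v + ?m\<^sup>2 * q v - 2 * (?m * norm (grad f v))"
          using f by (simp add: q_def power2_eq_square field_simps)
        finally show ?thesis by simp
      qed
      have "\<bar>2 * (f v * (gc R v \<bullet> s v))\<bar> \<le> 2 * (f v * (norm (gc R v) * norm (s v)))"
        using f0[of v] Cauchy_Schwarz_ineq2[of "gc R v" "s v"]
        by (simp add: abs_mult mult_left_mono)
      also have "\<dots> \<le> 2 * (f v * ((4 / R * ?m) * norm (s v)))"
        using cutoff_gradient_bound[OF R, of v] f0[of v]
        by (intro mult_left_mono mult_right_mono) (auto simp: gc_def)
      also have "\<dots> = 4 / R * (2 * (?m * (f v * norm (s v))))" by simp
      also have "\<dots> \<le> 4 / R * (2 * (?m * (f v * norm (u v) + norm (grad f v))))"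
        using R m fs by (intro mult_left_mono) auto
      also have "\<dots> \<le> 4 / R * ((2 * f v + f v * (norm (u v))\<^sup>2) + ?m\<^sup>2 * q v)"
        using R a b by (intro mult_left_mono) (auto simp: algebra_simps)
      finally show "\<bar>2 * (f v * (gc R v \<bullet> s v))\<bar>
          \<le> 4 / R * ((2 * f v + f v * (norm (u v))\<^sup>2) + ?m\<^sup>2 * q v)" .
    qed
    also have "\<dots> = 4 / R * (K + (\<integral>v. (cutoff R v)\<^sup>2 * q v \<partial>lborel))"
      unfolding K_def Bochner_Integration.integral_add[OF K_int cq, symmetric]
      by (rule integral_mult_right_zero)
    finally show "\<bar>(\<integral>v. (cutoff R v)\<^sup>2 * q v \<partial>lborel) - (\<integral>v. (cutoff R v)\<^sup>2 * h v \<partial>lborel)\<bar>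
         \<le> 4 / R * (K + (\<integral>v. (cutoff R v)\<^sup>2 * q v \<partial>lborel))" .
  qed

  \<comment> \<open>Starting at radius 8 keeps \<open>4 / R\<close> at most \<open>1 / 2\<close>, so
    at least half of \<open>I k\<close> survives the absorption.\<close>
  define c where "c k v = cutoff (real k + 8) v" for k :: nat and v :: 'a
  define I where "I k = (\<integral>v. (c k v)\<^sup>2 * q v \<partial>lborel)" for k
  define H where "H k = (\<integral>v. (c k v)\<^sup>2 * h v \<partial>lborel)" for k
  have c01: "0 \<le> c k v" "c k v \<le> 1" for k v
    by (auto simp: c_def cutoff_nonneg cutoff_le_1)
  have c_meas [measurable]: "c k \<in> borel_measurable borel" for k
    unfolding c_def [abs_def] by measurable
  have Iint: "integrable lborel (\<lambda>v. (c k v)\<^sup>2 * q v)" and Hint: "integrable lborel (\<lambda>v. (c k v)\<^sup>2 * h v)"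
    and IH: "\<bar>I k - H k\<bar> \<le> 4 / (real k + 8) * (K + I k)" for k
    unfolding I_def H_def c_def by (rule cut; simp)+
  have K0: "0 \<le> K"
    unfolding K_def using f0 by (intro integral_nonneg_AE AE_I2) simp
  have I0: "0 \<le> I k" for k
    unfolding I_def using q0 by (intro integral_nonneg_AE AE_I2) simp
  \<comment> \<open>Solving \<open>I k <= H k + (K + I k) / 2\<close> for \<open>I k\<close> gives
    \<open>2 * H k + K\<close>; then \<open>H k\<close> is at most the integral of
    \<open>\<bar>h\<bar>\<close>.\<close>
  define B where "B = 2 * (\<integral>v. \<bar>h v\<bar> \<partial>lborel) + K"
  have IB: "I k \<le> B" for k
  proof -
    have "H k \<le> (\<integral>v. \<bar>h v\<bar> \<partial>lborel)"
      unfolding H_def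
    proof (rule integral_mono[OF Hint])
      show "(c k v)\<^sup>2 * h v \<le> \<bar>h v\<bar>" for v
      proof -
        have "(c k v)\<^sup>2 * h v \<le> (c k v)\<^sup>2 * \<bar>h v\<bar>"
          by (intro mult_left_mono) auto
        also have "\<dots> \<le> \<bar>h v\<bar>"
          using c01[of k v] by (intro mult_left_le_one_le power_le_one) auto
        finally show ?thesis .
      qed
    qed (use h_int in simp)
    moreover have "4 / (real k + 8) * (K + I k) \<le> 1 / 2 * (K + I k)"
      using K0 I0[of k] by (intro mult_right_mono) (auto simp: field_simps)
    ultimately show ?thesis using IH[of k] unfolding B_def by argo
  qed
  have "incseq I"
    unfolding I_def
  proof (intro incseq_SucI integral_mono[OF Iint Iint] mult_right_mono power_mono)
    show "c k v \<le> c (Suc k) v" for k v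
      unfolding c_def by (rule cutoff_mono) auto
  qed (use c01 q0 in auto)
  then obtain L where L: "I \<longlonglongrightarrow> L"
    by (rule incseq_convergent[of I B]) (use IB in auto)
  have c_lim: "(\<lambda>k. c k v) \<longlonglongrightarrow> 1" for v
    unfolding c_def by (rule cutoff_tendsto)
  have q_int: "integrable lborel q" "(\<integral>v. q v \<partial>lborel) = L"
  proof -
    \<comment> \<open>Monotone convergence is the right tool here: no integrable majorant of
      \<open>q\<close> is at hand, but the cutoffs increase and the integrals \<open>I k\<close>
      stay below \<open>B\<close>.\<close>
    have m: "AE v in lborel. mono (\<lambda>k. (c k v)\<^sup>2 * q v)"
    proof (intro AE_I2 incseq_SucI mult_right_mono power_mono)
      show "c k v \<le> c (Suc k) v" for k v
        unfolding c_def by (rule cutoff_mono) auto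
    qed (use c01 q0 in auto)
    have l: "AE v in lborel. (\<lambda>k. (c k v)\<^sup>2 * q v) \<longlonglongrightarrow> q v"
      using tendsto_mult[OF tendsto_power[OF c_lim, where n = 2] tendsto_const] by simp
    show "integrable lborel q" "(\<integral>v. q v \<partial>lborel) = L"
      using integral_monotone_convergence_nonneg[OF Iint m _ l, of L] q0 L
      by (auto simp: I_def [abs_def])
  qed
  have "H \<longlonglongrightarrow> (\<integral>v. h v \<partial>lborel)"
    unfolding H_def
  proof (rule integral_dominated_convergence[where w = "\<lambda>v. \<bar>h v\<bar>"])
    show "AE v in lborel. (\<lambda>k. (c k v)\<^sup>2 * h v) \<longlonglongrightarrow> h v"
      using tendsto_mult[OF tendsto_power[OF c_lim, where n = 2] tendsto_const] by simp
    show "AE v in lborel. norm ((c k v)\<^sup>2 * h v) \<le> \<bar>h v\<bar>" for k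
      using c01 by (intro AE_I2) (auto simp: abs_mult intro!: mult_left_le_one_le power_le_one)
  qed (use h_int in auto)
  \<comment> \<open>With \<open>I k\<close> bounded, the self-referential estimate becomes a genuine
    one of order \<open>1 / k\<close>.\<close>
  moreover have "(\<lambda>k. I k - H k) \<longlonglongrightarrow> 0"
  proof (rule Lim_null_comparison)
    show "\<forall>\<^sub>F k in sequentially. norm (I k - H k) \<le> 4 / (real k + 8) * (K + B)"
    proof (intro always_eventually allI)
      fix k
      have "4 / (real k + 8) * (K + I k) \<le> 4 / (real k + 8) * (K + B)"
        using IB[of k] by (intro mult_left_mono) auto
      then show "norm (I k - H k) \<le> 4 / (real k + 8) * (K + B)" using IH[of k] by simp
    qed
    show "(\<lambda>k. 4 / (real k + 8) * (K + B)) \<longlonglongrightarrow> 0" by real_asymp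
  qed
  ultimately have "(\<lambda>k. I k - H k + H k) \<longlonglongrightarrow> 0 + (\<integral>v. h v \<partial>lborel)"
    by (intro tendsto_add)
  then have "L = (\<integral>v. h v \<partial>lborel)"
    using L LIMSEQ_unique by simp
  then show "(\<integral>v. f v * (norm (s v - grad f v /\<^sub>R f v))\<^sup>2 \<partial>lborel)
       - (\<integral>v. f v * ((norm (s v))\<^sup>2 + 2 * divg s v) \<partial>lborel)
       = (\<integral>v. (norm (grad f v))\<^sup>2 / f v \<partial>lborel)"
    using q_int(2) u_int d_int unfolding h_def u_def q_def by simp
  show "integrable lborel (\<lambda>v. (norm (grad f v))\<^sup>2 / f v)"
    using q_int(1) by (simp add: q_def [abs_def])
qed

text \<open>Although \<open>r\<close> is differentiable in the second variable only, each partial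
  derivative is a pointwise limit of difference quotients that are jointly measurable in both
  variables.\<close>

lemma borel_measurable_grad_snd:
  fixes r :: "'a::euclidean_space \<Rightarrow> 'b::euclidean_space \<Rightarrow> real"
  assumes meas: "(\<lambda>(x, v). r x v) \<in> borel_measurable borel"
    and diff: "\<And>x v. r x differentiable (at v)"
  shows "(\<lambda>(x, v). grad (r x) v) \<in> borel_measurable borel"
proof -
  have comp: "(\<lambda>z. frechet_derivative (r (fst z)) (at (snd z)) i) \<in> borel_measurable borel" for i
  proof (rule borel_measurable_LIMSEQ_real)
    show "(\<lambda>k. (r (fst z) (snd z + inverse (real (Suc k)) *\<^sub>R i) - r (fst z) (snd z)) / inverse (real (Suc k)))
        \<longlonglongrightarrow> frechet_derivative (r (fst z)) (at (snd z)) i" for z :: "'a \<times> 'b"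
      using diff frechet_derivative_works by (intro difference_quotient_LIMSEQ) blast
  next
    fix k
    have "(\<lambda>z. (fst z, snd z + inverse (real (Suc k)) *\<^sub>R i))
        \<in> borel_measurable (borel :: ('a \<times> 'b) measure)"
      by (intro borel_measurable_continuous_onI continuous_intros)
    from measurable_compose[OF this meas]
    have "(\<lambda>z. r (fst z) (snd z + inverse (real (Suc k)) *\<^sub>R i)) \<in> borel_measurable borel" by simp
    moreover have "(\<lambda>z. r (fst z) (snd z)) \<in> borel_measurable borel"
      using meas by (simp add: case_prod_unfold)
    ultimately show "(\<lambda>z. (r (fst z) (snd z + inverse (real (Suc k)) *\<^sub>R i) - r (fst z) (snd z))
        / inverse (real (Suc k))) \<in> borel_measurable borel"
      by measurable
  qed
  show ?thesis
    unfolding grad_def case_prod_unfold using comp by measurable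
qed

text \<open>The Fisher integrand \<open>P\<close> is not assumed integrable on the product. Being
  nonnegative, it has fibre integrals that also are the integrals of its norm. By the fibre identity
  they agree almost everywhere with a difference of two integrable functions of \<open>x\<close>,
  which is what Fubini's criterion asks for.\<close>

lemma implicit_score_product:
  fixes r :: "'a::euclidean_space \<Rightarrow> 'b::euclidean_space \<Rightarrow> real" and s :: "'a \<Rightarrow> 'b \<Rightarrow> 'b"
  assumes r0: "\<And>x v. 0 \<le> r x v"
    and r_meas: "(\<lambda>(x, v). r x v) \<in> borel_measurable borel"
    and r_diff: "\<And>x v. r x differentiable (at v)"
    and r_cont: "\<And>x. continuous_on UNIV (grad (r x))"
    and s_diff: "\<And>x v. s x differentiable (at v)"
    and s_cont: "\<And>x i. i \<in> Basis \<Longrightarrow> continuous_on UNIV (\<lambda>v. frechet_derivative (s x) (at v) i)"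
    and r_int: "integrable lborel (\<lambda>(x, v). r x v)"
    and u_int: "integrable lborel (\<lambda>(x, v). r x v * (norm (s x v - grad (r x) v /\<^sub>R r x v))\<^sup>2)"
    and d_int: "integrable lborel (\<lambda>(x, v). r x v * ((norm (s x v))\<^sup>2 + 2 * divg (s x) v))"
  shows "integrable lborel (\<lambda>(x, v). (norm (grad (r x) v))\<^sup>2 / r x v)"
    and "(\<integral>(x, v). r x v * (norm (s x v - grad (r x) v /\<^sub>R r x v))\<^sup>2 \<partial>lborel)
       - (\<integral>(x, v). r x v * ((norm (s x v))\<^sup>2 + 2 * divg (s x) v) \<partial>lborel)
       = (\<integral>(x, v). (norm (grad (r x) v))\<^sup>2 / r x v \<partial>lborel)"
proof -
  define U where "U = (\<lambda>(x, v). r x v * (norm (s x v - grad (r x) v /\<^sub>R r x v))\<^sup>2)"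
  define E where "E = (\<lambda>(x, v). r x v * ((norm (s x v))\<^sup>2 + 2 * divg (s x) v))"
  define P where "P = (\<lambda>(x, v). (norm (grad (r x) v))\<^sup>2 / r x v)"
  have ints: "integrable (lborel \<Otimes>\<^sub>M lborel) (\<lambda>(x, v). r x v)"
      "integrable (lborel \<Otimes>\<^sub>M lborel) U" "integrable (lborel \<Otimes>\<^sub>M lborel) E"
    using r_int u_int d_int by (simp_all add: lborel_prod U_def E_def)
  have P_meas [measurable]: "P \<in> borel_measurable (lborel \<Otimes>\<^sub>M lborel)"
  proof -
    have [measurable]: "(\<lambda>z. r (fst z) (snd z)) \<in> borel_measurable borel"
        "(\<lambda>z. grad (r (fst z)) (snd z)) \<in> borel_measurable borel"
      using r_meas borel_measurable_grad_snd[OF r_meas r_diff] by (simp_all add: case_prod_unfold)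
    show ?thesis
      unfolding P_def case_prod_unfold lborel_prod by measurable
  qed
  have fibre: "AE x in lborel. integrable lborel (\<lambda>v. P (x, v)) \<and>
      (\<integral>v. U (x, v) \<partial>lborel) - (\<integral>v. E (x, v) \<partial>lborel) = (\<integral>v. P (x, v) \<partial>lborel)"
    using lborel_pair.AE_integrable_fst'[OF ints(1)] lborel_pair.AE_integrable_fst'[OF ints(2)]
      lborel_pair.AE_integrable_fst'[OF ints(3)]
  proof eventually_elim
    case (elim x)
    then show ?case
      using implicit_score_fibre[of "r x" "s x", OF r0 r_diff r_cont s_diff s_cont]
      by (simp add: U_def E_def P_def)
  qed
  have P_int: "integrable (lborel \<Otimes>\<^sub>M lborel) P"
  proof (rule lborel_pair.Fubini_integrable[OF P_meas])
    have UE: "integrable lborel (\<lambda>x. (\<integral>v. U (x, v) \<partial>lborel) - (\<integral>v. E (x, v) \<partial>lborel))"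
      using lborel_pair.integrable_fst'[OF ints(2)] lborel_pair.integrable_fst'[OF ints(3)] by simp
    have "norm (P z) = P z" for z
      using r0 by (simp add: P_def case_prod_unfold)
    then show "integrable lborel (\<lambda>x. \<integral>v. norm (P (x, v)) \<partial>lborel)"
      using fibre by (intro integrable_cong_AE_imp[OF UE]) auto
    show "AE x in lborel. integrable lborel (\<lambda>v. P (x, v))"
      using fibre by auto
  qed
  then show "integrable lborel (\<lambda>(x, v). (norm (grad (r x) v))\<^sup>2 / r x v)"
    by (simp add: P_def lborel_prod)
  have "(\<integral>x. (\<integral>v. P (x, v) \<partial>lborel) \<partial>lborel)
      = (\<integral>x. (\<integral>v. U (x, v) \<partial>lborel) - (\<integral>v. E (x, v) \<partial>lborel) \<partial>lborel)"
    using fibre lborel_pair.integrable_fst'[OF ints(2)] lborel_pair.integrable_fst'[OF ints(3)]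
      lborel_pair.integrable_fst'[OF P_int]
    by (intro integral_cong_AE) auto
  also have "\<dots> = (\<integral>x. (\<integral>v. U (x, v) \<partial>lborel) \<partial>lborel) - (\<integral>x. (\<integral>v. E (x, v) \<partial>lborel) \<partial>lborel)"
    using lborel_pair.integrable_fst'[OF ints(2)] lborel_pair.integrable_fst'[OF ints(3)]
    by (rule Bochner_Integration.integral_diff)
  finally show "(\<integral>(x, v). r x v * (norm (s x v - grad (r x) v /\<^sub>R r x v))\<^sup>2 \<partial>lborel)
       - (\<integral>(x, v). r x v * ((norm (s x v))\<^sup>2 + 2 * divg (s x) v) \<partial>lborel)
       = (\<integral>(x, v). (norm (grad (r x) v))\<^sup>2 / r x v \<partial>lborel)"
    unfolding lborel_pair.integral_fst'[OF P_int] lborel_pair.integral_fst'[OF ints(2)]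
      lborel_pair.integral_fst'[OF ints(3)]
    by (simp add: P_def U_def E_def lborel_prod)
qed

section \<open>Positivity of the Fisher information\<close>

lemma integrable_const_lborel_imp_0:
  assumes "integrable lborel (\<lambda>_::'a::euclidean_space. c::real)"
  shows "c = 0"
  using assms by (cases "c = 0") (auto simp: integrable_iff_bounded ennreal_mult_top)

text \<open>If the Fisher information vanished, almost every \<open>r x\<close> would be an integrable constant.\<close>

lemma fisher_information_pos:
  fixes r :: "'a::euclidean_space \<Rightarrow> 'b::euclidean_space \<Rightarrow> real"
  assumes r0: "\<And>x v. 0 \<le> r x v"
    and r_diff: "\<And>x v. r x differentiable (at v)"
    and r_cont: "\<And>x. continuous_on UNIV (grad (r x))"
    and r_int: "integrable lborel (\<lambda>(x, v). r x v)"
    and P_int: "integrable lborel (\<lambda>(x, v). (norm (grad (r x) v))\<^sup>2 / r x v)"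
    and mass: "(\<integral>(x, v). r x v \<partial>lborel) \<noteq> 0"
  shows "0 < (\<integral>(x, v). (norm (grad (r x) v))\<^sup>2 / r x v \<partial>lborel)"
proof (rule ccontr)
  let ?P = "\<lambda>(x, v). (norm (grad (r x) v))\<^sup>2 / r x v"
  have nn: "AE z in lborel. 0 \<le> ?P z"
    using r0 by (auto simp: case_prod_unfold)
  assume "\<not> 0 < (\<integral>z. ?P z \<partial>lborel)"
  then have "(\<integral>z. ?P z \<partial>lborel) = 0"
    using integral_nonneg_AE[OF nn] by linarith
  then have "AE z in lborel. ?P z = 0"
    using integral_nonneg_eq_0_iff_AE[OF P_int nn] by simp
  \<comment> \<open>The quotient is also 0 where \<open>r\<close> vanishes, by the convention for
    division by 0. Such points are minima of the fibre, so the gradient is 0 there too.\<close>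
  then have "AE z in lborel. grad (r (fst z)) (snd z) = 0"
  proof eventually_elim
    case (elim z)
    then show ?case
      using grad_eq_0_at_min[OF r_diff, of "fst z" "snd z"] r0[of "fst z"]
      by (auto simp: case_prod_unfold)
  qed
  then have "AE z in lborel \<Otimes>\<^sub>M lborel. grad (r (fst z)) (snd z) = 0"
    unfolding lborel_prod .
  then have g0: "AE x in lborel. AE v in lborel. grad (r x) v = 0"
    using lborel_pair.AE_pair by force
  have ri: "integrable (lborel \<Otimes>\<^sub>M lborel) (\<lambda>(x, v). r x v)"
    using r_int by (simp add: lborel_prod)
  have "AE x in lborel. (\<integral>v. r x v \<partial>lborel) = 0"
    using g0 lborel_pair.AE_integrable_fst'[OF ri]
  proof eventually_elim
    case (elim x)
    \<comment> \<open>A closed set of full measure is the whole space. This upgrades the vanishing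
      of the gradient from almost everywhere to everywhere, as constancy of \<open>r x\<close>
      requires.\<close>
    have "closed {v. grad (r x) v = 0}"
      using closed_vimage[of "{0}" "grad (r x)"] r_cont by (simp add: vimage_def)
    moreover have "AE v in lebesgue. v \<in> {v. grad (r x) v = 0}"
      using elim(1) by (intro AE_completion) simp
    ultimately have "v \<in> {v. grad (r x) v = 0}" for v
      by (rule mem_closed_if_AE_lebesgue)
    then have "(r x has_derivative (\<lambda>h. 0)) (at v within UNIV)" for v
      using has_derivative_grad[OF r_diff, of x v] by simp
    then obtain c where "\<And>v. r x v = c"
      using has_derivative_zero_constant[of UNIV "r x"] by auto
    then show ?case
      using elim(2) integrable_const_lborel_imp_0[where 'a = 'b, of c] by simp
  qed
  then have "(\<integral>x. (\<integral>v. r x v \<partial>lborel) \<partial>lborel) = 0"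
    by (rule integral_eq_zero_AE)
  then show False
    using mass lborel_pair.integral_fst'[OF ri] by (simp add: lborel_prod)
qed

subsection \<open>The boundary is a null set\<close>

text \<open>Shifts of the graph piece by distinct multiples of \<open>e\<close> are disjoint and
  have equal measure. Infinitely many of them fit into one bounded ball, so that measure must be
  0.\<close>

lemma null_sets_graph:
  fixes e :: "'a::euclidean_space"
  assumes "norm e = 1" and inv: "\<And>x c. \<phi> (x + c *\<^sub>R e) = \<phi> x"
    and cont: "continuous_on (ball p r) \<phi>"
  shows "{x \<in> ball p r. x \<bullet> e = \<phi> x} \<in> null_sets lborel"
proof -
  define A where "A = {x \<in> ball p r. x \<bullet> e = \<phi> x}"
  \<comment> \<open>Distinct shift lengths, all at most 1, so every shifted copy \<open>S k\<close>
    stays inside \<open>ball p (r + 1)\<close>.\<close>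
  define c where "c k = inverse (real (Suc k))" for k
  define S where "S k = (+) (- c k *\<^sub>R e) -` A \<inter> space lborel" for k
  have [measurable]: "A \<in> sets borel"
  proof -
    have "closedin (top_of_set (ball p r)) (ball p r \<inter> (\<lambda>x. x \<bullet> e - \<phi> x) -` {0})"
      by (intro continuous_closedin_preimage continuous_intros cont)
    moreover have "ball p r \<inter> (\<lambda>x. x \<bullet> e - \<phi> x) -` {0} = A"
      by (auto simp: A_def)
    ultimately obtain C where "closed C" "A = ball p r \<inter> C"
      by (auto simp: closedin_closed)
    then show ?thesis by auto
  qed
  have S_meas: "S k \<in> sets lborel" for k
    unfolding S_def by measurable
  have S_em: "emeasure lborel (S k) = emeasure lborel A" for k
  proof -
    have "emeasure (distr lborel borel ((+) (- c k *\<^sub>R e))) A = emeasure lborel (S k)"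
      unfolding S_def by (rule emeasure_distr) auto
    then show ?thesis by (simp add: lborel_distr_plus)
  qed
  have S_eq: "x \<bullet> e - \<phi> x = c k" if "x \<in> S k" for x k
  proof -
    have "(x - c k *\<^sub>R e) \<bullet> e = \<phi> (x - c k *\<^sub>R e)"
      using that by (simp add: S_def A_def)
    moreover have "\<phi> (x - c k *\<^sub>R e) = \<phi> x"
      using inv[of x "- c k"] by simp
    moreover have "e \<bullet> e = 1"
      using assms(1) by (simp add: norm_eq_1)
    ultimately show ?thesis by (simp add: inner_diff_left)
  qed
  have disj: "disjoint_family S"
    unfolding disjoint_family_on_def
  proof (intro ballI impI)
    fix j k :: nat
    assume "j \<noteq> k"
    then have "c j \<noteq> c k" by (simp add: c_def)
    then show "S j \<inter> S k = {}" using S_eq by (metis disjoint_iff)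
  qed
  have S_sub: "S k \<subseteq> ball p (r + 1)" for k
  proof
    fix x assume "x \<in> S k"
    then have "dist p (x - c k *\<^sub>R e) < r" by (simp add: S_def A_def)
    moreover have "dist (x - c k *\<^sub>R e) x \<le> 1"
      using assms(1) by (simp add: dist_norm c_def field_simps)
    ultimately show "x \<in> ball p (r + 1)"
      using dist_triangle[of p x "x - c k *\<^sub>R e"] by simp
  qed
  have A_fin: "emeasure lborel A < \<infinity>"
    by (rule emeasure_bounded_finite) (auto simp: A_def intro: bounded_subset[OF bounded_ball])
  have bound: "real N * measure lborel A \<le> measure lborel (ball p (r + 1))" for N
  proof -
    have "ennreal (real N * measure lborel A) = (\<Sum>k<N. emeasure lborel (S k))"
      using A_fin by (simp add: S_em emeasure_eq_ennreal_measure ennreal_mult ennreal_of_nat_eq_real_of_nat)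
    also have "\<dots> = emeasure lborel (\<Union>k<N. S k)"
      using S_meas disj by (intro sum_emeasure) (auto simp: disjoint_family_on_def)
    also have "\<dots> \<le> emeasure lborel (ball p (r + 1))"
      using S_sub by (intro emeasure_mono) auto
    also have "\<dots> = ennreal (measure lborel (ball p (r + 1)))"
      by (rule emeasure_eq_ennreal_measure) (metis bounded_ball emeasure_bounded_finite less_irrefl infinity_ennreal_def)
    finally show ?thesis by simp
  qed
  have "measure lborel A \<le> 0"
  proof (rule ccontr)
    assume "\<not> measure lborel A \<le> 0"
    then obtain N where "measure lborel (ball p (r + 1)) < real N * measure lborel A"
      using reals_Archimedean3[of "measure lborel A"] by auto
    then show False using bound[of N] by simp
  qed
  then have "measure lborel A = 0" by (simp add: measure_le_0_iff)
  then have "emeasure lborel A = 0"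
    using A_fin by (simp add: emeasure_eq_ennreal_measure)
  then show ?thesis unfolding A_def[symmetric] by auto
qed

text \<open>A frontier point lies outside the open set \<open>G\<close>, hence not strictly below
  the graph; it is a limit of points of \<open>G\<close>, hence not strictly above it. So the
  frontier is locally contained in a graph, and negligibility is a local property. The order
  \<open>Suc k\<close> provides a derivative of \<open>\<phi>\<close>, hence its continuity.\<close>

lemma null_sets_frontier:
  fixes G :: "'a::euclidean_space set"
  assumes "open G" "Holder_boundary (Suc k) \<epsilon> G"
  shows "frontier G \<in> null_sets lborel"
proof -
  have "negligible (frontier G)"
  proof (subst locally_negligible_alt, intro ballI)
    fix p assume p: "p \<in> frontier G"
    then obtain e \<phi> r where lg: "local_graph G p e \<phi> r" and CH: "C_Holder (Suc k) \<epsilon> (ball p r) \<phi>"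
      using assms(2) unfolding Holder_boundary_def by blast
    from lg have r: "0 < r" and e: "norm e = 1" and inv: "\<And>x c. \<phi> (x + c *\<^sub>R e) = \<phi> x"
      and G: "G \<inter> ball p r = {x \<in> ball p r. x \<bullet> e < \<phi> x}"
      by (auto simp: local_graph_def)
    have cont: "continuous_on (ball p r) \<phi>"
      using CH by (intro continuous_at_imp_continuous_on) (auto intro: differentiable_imp_continuous_within)
    have sub: "frontier G \<inter> ball p r \<subseteq> {x \<in> ball p r. x \<bullet> e = \<phi> x}"
    proof
      fix x assume x: "x \<in> frontier G \<inter> ball p r"
      then have xG: "x \<in> closure G" "x \<notin> G"
        using assms(1) by (auto simp: frontier_def interior_open)
      have "\<phi> x \<le> x \<bullet> e" using G x xG by force
      moreover have "x \<bullet> e \<le> \<phi> x"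
      proof (rule ccontr)
        assume "\<not> x \<bullet> e \<le> \<phi> x"
        then have x1: "x \<in> ball p r \<inter> (\<lambda>y. y \<bullet> e - \<phi> y) -` {0<..}" using x by simp
        have "open (ball p r \<inter> (\<lambda>y. y \<bullet> e - \<phi> y) -` {0<..})"
          by (intro continuous_open_preimage continuous_intros cont) auto
        with x1 xG obtain y where "y \<in> G" "y \<in> ball p r \<inter> (\<lambda>y. y \<bullet> e - \<phi> y) -` {0<..}"
          using open_Int_closure_eq_empty by blast
        moreover from this have "y \<in> {x \<in> ball p r. x \<bullet> e < \<phi> x}" using G by blast
        ultimately show False by simp
      qed
      ultimately show "x \<in> {x \<in> ball p r. x \<bullet> e = \<phi> x}" using x by auto
    qed
    have "negligible {x \<in> ball p r. x \<bullet> e = \<phi> x}"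
      using null_sets_graph[OF e inv cont] by (simp add: negligible_iff_null_sets null_sets_completionI)
    then have "negligible (frontier G \<inter> ball p r)"
      using sub by (rule negligible_subset)
    then show "\<exists>U. openin (top_of_set (frontier G)) U \<and> p \<in> U \<and> negligible U"
      using p r by (intro exI[of _ "frontier G \<inter> ball p r"]) (auto intro: openin_open_Int)
  qed
  then show ?thesis
    by (simp add: negligible_iff_null_sets null_sets_completion_iff)
qed

subsection \<open>Implicit score matching for confined Langevin dynamics\<close>

text \<open>The Fisher information in the second variable, usually written as the integral of
  \<open>r |grad ln r|^2\<close>. The quotient form gives zeros of \<open>r\<close> the value
  0.\<close>

definition fisher_information :: "('a::euclidean_space \<Rightarrow> 'b::euclidean_space \<Rightarrow> real) \<Rightarrow> real" where
  "fisher_information r = (\<integral>(x, v). (norm (grad (r x) v))\<^sup>2 / r x v \<partial>lborel)"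

text \<open>Transfers the identity from Lebesgue integrals against \<open>r\<close> to expectations.
  The error \<open>e\<close> is abstract and has to match its formula only where \<open>r\<close> is
  positive: the law charges no other points, and the logarithm behaves well only there.\<close>

lemma implicit_score_identity:
  fixes r :: "'a::euclidean_space \<Rightarrow> 'b::euclidean_space \<Rightarrow> real" and s :: "'a \<Rightarrow> 'b \<Rightarrow> 'b"
  assumes "prob_space M"
    and distr: "distributed M lborel (\<lambda>\<omega>. (X \<omega>, V \<omega>)) (\<lambda>z. ennreal (r (fst z) (snd z)))"
    and r0: "\<And>x v. 0 \<le> r x v"
    and r_diff: "\<And>x v. r x differentiable (at v)"
    and r_cont: "\<And>x. continuous_on UNIV (grad (r x))"
    and s_cont: "continuous_on UNIV (\<lambda>(x, v). s x v)"
    and s_diff: "\<And>x v. s x differentiable (at v)"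
    and ds_cont: "\<And>i. i \<in> Basis \<Longrightarrow> continuous_on UNIV (\<lambda>(x, v). frechet_derivative (s x) (at v) i)"
    and e_int: "integrable M e"
    and e_eq: "AE \<omega> in M. 0 < r (X \<omega>) (V \<omega>) \<longrightarrow>
      e \<omega> = (norm (s (X \<omega>) (V \<omega>) - grad (r (X \<omega>)) (V \<omega>) /\<^sub>R r (X \<omega>) (V \<omega>)))\<^sup>2"
    and d_int: "integrable (distr M borel (\<lambda>\<omega>. (X \<omega>, V \<omega>))) (\<lambda>(x, v). (norm (s x v))\<^sup>2 + 2 * divg (s x) v)"
  shows "0 < fisher_information r"
    and "(\<integral>\<omega>. e \<omega> \<partial>M)
      - (\<integral>(x, v). (norm (s x v))\<^sup>2 + 2 * divg (s x) v \<partial>distr M borel (\<lambda>\<omega>. (X \<omega>, V \<omega>)))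
      = fisher_information r"
proof -
  interpret prob_space M by fact
  define Z where "Z \<omega> = (X \<omega>, V \<omega>)" for \<omega>
  define u where "u z = (norm (s (fst z) (snd z) - grad (r (fst z)) (snd z) /\<^sub>R r (fst z) (snd z)))\<^sup>2" for z
  define d where "d z = (norm (s (fst z) (snd z)))\<^sup>2 + 2 * divg (s (fst z)) (snd z)" for z
  note distr' = distr[folded Z_def]
  have r_meas: "(\<lambda>z. r (fst z) (snd z)) \<in> borel_measurable borel"
    using distributed_real_measurable[OF _ distr'] r0 by simp
  have r_meas': "(\<lambda>(x, v). r x v) \<in> borel_measurable borel"
    using r_meas by (simp add: case_prod_unfold)
  have g_meas: "(\<lambda>z. grad (r (fst z)) (snd z)) \<in> borel_measurable borel"
    using borel_measurable_grad_snd[OF r_meas' r_diff] by (simp add: case_prod_unfold)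
  have s_meas: "(\<lambda>z. s (fst z) (snd z)) \<in> borel_measurable borel"
    using s_cont by (intro borel_measurable_continuous_onI) (simp add: case_prod_unfold)
  have divg_meas: "(\<lambda>z. divg (s (fst z)) (snd z)) \<in> borel_measurable borel"
    using ds_cont unfolding divg_def
    by (intro borel_measurable_continuous_onI continuous_intros) (simp add: case_prod_unfold)
  have u_meas [measurable]: "u \<in> borel_measurable borel"
    unfolding u_def [abs_def] using r_meas g_meas s_meas by measurable
  have d_meas [measurable]: "d \<in> borel_measurable borel"
    unfolding d_def [abs_def] using s_meas divg_meas by measurable
  have Z_meas [measurable]: "Z \<in> borel_measurable M"
    using distributed_measurable[OF distr'] by simp

  have "AE z in distr M lborel Z. 0 < r (fst z) (snd z)"
    unfolding distributed_distr_eq_density[OF distr']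
    using r_meas by (subst AE_density) auto
  then have pos: "AE \<omega> in M. 0 < r (X \<omega>) (V \<omega>)"
    using r_meas by (subst (asm) AE_distr_iff) (auto simp: Z_def)
  have e_eq': "AE \<omega> in M. e \<omega> = u (Z \<omega>)"
    using pos e_eq by eventually_elim (simp add: u_def Z_def)
  have uZ_int: "integrable M (\<lambda>\<omega>. u (Z \<omega>))"
    using e_int _ e_eq' by (rule integrable_cong_AE_imp) measurable
  have e_val: "(\<integral>\<omega>. e \<omega> \<partial>M) = (\<integral>\<omega>. u (Z \<omega>) \<partial>M)"
    using e_eq' e_int uZ_int by (intro integral_cong_AE) auto
  have d_eq: "(\<lambda>(x, v). (norm (s x v))\<^sup>2 + 2 * divg (s x) v) = d"
    by (auto simp: d_def)
  have dZ_int: "integrable M (\<lambda>\<omega>. d (Z \<omega>))"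
    using d_int unfolding d_eq Z_def[symmetric] by (simp add: integrable_distr_eq)
  have d_val: "(\<integral>z. d z \<partial>distr M borel Z) = (\<integral>\<omega>. d (Z \<omega>) \<partial>M)"
    by (rule integral_distr) auto

  have r_int: "integrable lborel (\<lambda>(x, v). r x v)"
    using distributed_integrable[OF distr', of "\<lambda>_. 1"] r0 by (simp add: case_prod_unfold)
  have mass: "(\<integral>(x, v). r x v \<partial>lborel) \<noteq> 0"
    using distributed_integral[OF distr', of "\<lambda>_. 1"] r0 by (simp add: case_prod_unfold prob_space)
  have u_int: "integrable lborel (\<lambda>(x, v). r x v * (norm (s x v - grad (r x) v /\<^sub>R r x v))\<^sup>2)"
    and u_val: "(\<integral>(x, v). r x v * (norm (s x v - grad (r x) v /\<^sub>R r x v))\<^sup>2 \<partial>lborel) = (\<integral>\<omega>. u (Z \<omega>) \<partial>M)"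
    using distributed_integrable[OF distr', of u] distributed_integral[OF distr', of u] r0 uZ_int
    by (simp_all add: case_prod_unfold u_def)
  have di_int: "integrable lborel (\<lambda>(x, v). r x v * ((norm (s x v))\<^sup>2 + 2 * divg (s x) v))"
    and di_val: "(\<integral>(x, v). r x v * ((norm (s x v))\<^sup>2 + 2 * divg (s x) v) \<partial>lborel) = (\<integral>\<omega>. d (Z \<omega>) \<partial>M)"
    using distributed_integrable[OF distr', of d] distributed_integral[OF distr', of d] r0 dZ_int
    by (simp_all add: case_prod_unfold d_def)
  have ds_cont': "continuous_on UNIV (\<lambda>v. frechet_derivative (s x) (at v) i)" if "i \<in> Basis" for x i
    using continuous_on_compose2[OF ds_cont[OF that], of UNIV "\<lambda>v. (x, v)"]
    by (simp add: continuous_on_Pair)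
  note product = implicit_score_product[OF r0 r_meas' r_diff r_cont s_diff ds_cont' r_int u_int di_int]
  show "0 < fisher_information r"
    unfolding fisher_information_def
    by (rule fisher_information_pos[OF r0 r_diff r_cont r_int product(1) mass])
  show "(\<integral>\<omega>. e \<omega> \<partial>M)
      - (\<integral>(x, v). (norm (s x v))\<^sup>2 + 2 * divg (s x) v \<partial>distr M borel (\<lambda>\<omega>. (X \<omega>, V \<omega>)))
      = fisher_information r"
    unfolding d_eq e_val Z_def[symmetric] d_val fisher_information_def
    using product(2) by (simp add: u_val di_val)
qed

text \<open>The given derivative is only a derivative within the product set, which matters at
  endpoints of a closed time interval. Lines in the velocity direction never leave that set, so the
  chain rule along them yields an unrestricted derivative in \<open>v\<close>.\<close>

lemma C1_on_slice:
  fixes s :: "real \<Rightarrow> 'a::euclidean_space \<Rightarrow> 'b::euclidean_space \<Rightarrow> 'c::euclidean_space"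
  assumes "C1_on (A \<times> UNIV \<times> UNIV) (\<lambda>(t, x, v). s t x v)" and t: "t \<in> A"
  shows "continuous_on UNIV (\<lambda>(x, v). s t x v)"
    and "s t x differentiable (at v)"
    and "continuous_on UNIV (\<lambda>(x, v). frechet_derivative (s t x) (at v) i)"
proof -
  let ?S = "A \<times> (UNIV :: 'a set) \<times> (UNIV :: 'b set)"
  let ?f = "\<lambda>(t, x, v). s t x v"
  obtain D where D: "\<And>z. z \<in> ?S \<Longrightarrow> (?f has_derivative blinfun_apply (D z)) (at z within ?S)"
    and D_cont: "continuous_on ?S D"
    using assms(1) unfolding C1_on_def by blast
  have f_cont: "continuous_on ?S ?f"
    using D by (rule has_derivative_continuous_on)
  have "continuous_on UNIV (\<lambda>z. ?f (t, fst z, snd z))"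
    by (rule continuous_on_compose2[OF f_cont]) (use t in \<open>auto intro!: continuous_intros\<close>)
  then show "continuous_on UNIV (\<lambda>(x, v). s t x v)"
    by (simp add: case_prod_unfold)
  have der: "(s t x has_derivative (\<lambda>h. D (t, x, v) (0, 0, h))) (at v)" for x v
  proof -
    have "((\<lambda>v. ?f (t, x, v)) has_derivative (\<lambda>h. D (t, x, v) (0, 0, h))) (at v)"
    proof (rule has_derivative_in_compose2[OF D])
      show "((\<lambda>v. (t, x, v)) has_derivative (\<lambda>h. (0, 0, h))) (at v)"
        by (auto intro!: derivative_eq_intros)
    qed (use t in auto)
    then show ?thesis by simp
  qed
  then show "s t x differentiable (at v)"
    unfolding differentiable_def by blast
  have eq: "frechet_derivative (s t x) (at v) i = D (t, x, v) (0, 0, i)" for x v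
    using frechet_derivative_at[OF der[of x v], symmetric] by simp
  have "continuous_on UNIV (\<lambda>z. D (t, fst z, snd z))"
    by (rule continuous_on_compose2[OF D_cont]) (use t in \<open>auto intro!: continuous_intros\<close>)
  then have "continuous_on UNIV (\<lambda>z. D (t, fst z, snd z) (0, 0, i))"
    by (rule bounded_linear.continuous_on[OF blinfun.bounded_linear_left])
  then show "continuous_on UNIV (\<lambda>(x, v). frechet_derivative (s t x) (at v) i)"
    by (simp add: eq case_prod_unfold)
qed

lemma AE_lborel_fst_notin_null:
  fixes N :: "'a::euclidean_space set"
  assumes "N \<in> null_sets lborel"
  shows "AE z in (lborel :: ('a \<times> 'b::euclidean_space) measure). fst z \<notin> N"
proof -
  have "N \<times> (UNIV :: 'b set) \<in> null_sets (lborel \<Otimes>\<^sub>M lborel)"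
    using assms by (auto simp: null_sets_def lborel.emeasure_pair_measure_Times)
  then have "AE z in lborel \<Otimes>\<^sub>M lborel. z \<notin> N \<times> (UNIV :: 'b set)"
    by (rule AE_not_in)
  then show ?thesis
    unfolding lborel_prod by eventually_elim auto
qed

text \<open>The Fokker-Planck equation gives velocity derivatives of \<open>\<rho>\<close> for
  \<open>x\<close> in \<open>G\<close> only, whereas the density lives on the closure. Multiplying
  by the indicator of \<open>G\<close> makes all other fibres identically 0, so regularity holds for
  every \<open>x\<close>; the density changes only above the frontier, a null set.\<close>

lemma score_error_at_time:
  fixes G :: "'a::euclidean_space set" and \<rho> :: "real \<Rightarrow> 'a \<Rightarrow> 'a \<Rightarrow> real"
  defines "r \<equiv> \<lambda>t x v. indicator G x * \<rho> t x v"
  assumes G: "open G" "frontier G \<in> null_sets lborel"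
    and "prob_space M"
    and dens: "has_marginal_densities M T G X V \<rho>"
    and fp: "fokker_planck_specular T G n b \<gamma> \<rho>"
    and C1: "C1_on ({0..T} \<times> UNIV \<times> UNIV) (\<lambda>(t, x, v). s t x v)"
    and t: "t \<in> {0<..<T}"
    and e_int: "integrable M (score_error \<rho> X V s t)"
    and d_int: "integrable (marginal_law M X V t) (implicit_score_integrand s t)"
  shows "0 < fisher_information (r t)"
    and "(\<integral>\<omega>. score_error \<rho> X V s t \<omega> \<partial>M)
      - (\<integral>z. implicit_score_integrand s t z \<partial>marginal_law M X V t) = fisher_information (r t)"
proof -
  interpret prob_space M by fact
  have \<rho>0: "\<And>x v. x \<in> closure G \<Longrightarrow> 0 \<le> \<rho> t x v"
    and distr0: "distributed M lborel (\<lambda>\<omega>. (X t \<omega>, V t \<omega>))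
      (\<lambda>(x, v). ennreal (indicator (closure G) x * \<rho> t x v))"
    using dens t unfolding has_marginal_densities_def by auto
  have \<rho>_diff: "\<rho> t x differentiable (at v)" and \<rho>_diff2: "grad (\<rho> t x) differentiable (at v)"
    if "x \<in> G" for x v
    using fp t that unfolding fokker_planck_specular_def by blast+
  have r_in: "r t x = \<rho> t x" if "x \<in> G" for x
    using that by (auto simp: r_def)
  have r_out: "r t x = (\<lambda>_. 0)" if "x \<notin> G" for x
    using that by (auto simp: r_def)
  have r0: "0 \<le> r t x v" for x v
    using \<rho>0[of x v] closure_subset[of G] by (auto simp: r_def indicator_def)
  have r_diff: "r t x differentiable (at v)" for x v
    using \<rho>_diff by (cases "x \<in> G") (auto simp: r_in r_out)
  \<comment> \<open>Second-order differentiability in \<open>v\<close>, part of the notion of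
    classical solution, is used here as continuity of the gradient.\<close>
  have r_cont: "continuous_on UNIV (grad (r t x))" for x
  proof (cases "x \<in> G")
    case True
    then show ?thesis
      using \<rho>_diff2
      by (auto simp: r_in intro!: continuous_at_imp_continuous_on differentiable_imp_continuous_within)
  next
    case False
    have "grad (\<lambda>_. 0 :: real) = (\<lambda>_ :: 'a. 0)"
      by (intro ext grad_unique) simp
    then show ?thesis using False by (simp add: r_out)
  qed

  have G_sets: "G \<times> (UNIV :: 'a set) \<in> sets borel"
    using G(1) by (intro borel_open open_Times) auto
  let ?f = "\<lambda>(x, v). ennreal (indicator (closure G) x * \<rho> t x v)"
  have f_meas: "?f \<in> borel_measurable lborel"
    using distr0 by (rule distributed_borel_measurable)
  have r_eq: "ennreal (r t (fst z) (snd z)) = indicator (G \<times> UNIV) z * ?f z" for z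
    using closure_subset[of G] by (cases z) (auto simp: r_def indicator_def)
  have ae: "AE z in lborel. ?f z = ennreal (r t (fst z) (snd z))"
    using AE_lborel_fst_notin_null[OF G(2)]
  proof eventually_elim
    case (elim z)
    then show ?case
      using G(1) closure_subset[of G]
      by (auto simp: r_def frontier_def interior_open indicator_def case_prod_unfold)
  qed
  have r_meas: "(\<lambda>z. ennreal (r t (fst z) (snd z))) \<in> borel_measurable lborel"
    unfolding r_eq using f_meas G_sets by (intro borel_measurable_times_ennreal) auto
  have distr: "distributed M lborel (\<lambda>\<omega>. (X t \<omega>, V t \<omega>)) (\<lambda>z. ennreal (r t (fst z) (snd z)))"
    by (rule iffD1[OF distributed_cong_density[OF ae r_meas f_meas] distr0])

  have Z_meas: "(\<lambda>\<omega>. (X t \<omega>, V t \<omega>)) \<in> borel_measurable M"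
    using distributed_measurable[OF distr] by simp
  have "AE z in distr M lborel (\<lambda>\<omega>. (X t \<omega>, V t \<omega>)). z \<in> G \<times> UNIV"
    unfolding distributed_distr_eq_density[OF distr]
    using f_meas G_sets unfolding r_eq by (subst AE_density) (auto simp: indicator_def)
  then have "AE \<omega> in M. X t \<omega> \<in> G"
    using Z_meas G_sets by (subst (asm) AE_distr_iff) auto
  then have err: "AE \<omega> in M. 0 < r t (X t \<omega>) (V t \<omega>) \<longrightarrow> score_error \<rho> X V s t \<omega>
      = (norm (s t (X t \<omega>) (V t \<omega>)
          - grad (r t (X t \<omega>)) (V t \<omega>) /\<^sub>R r t (X t \<omega>) (V t \<omega>)))\<^sup>2"
  proof eventually_elim
    case (elim \<omega>)
    \<comment> \<open>For a position in \<open>G\<close>, \<open>r\<close> and \<open>\<rho>\<close>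
      agree as functions of the whole velocity variable, not just at one point, so their logarithmic
      gradients agree.\<close>
    then have "score \<rho> t (X t \<omega>) (V t \<omega>) = grad (\<lambda>w. ln (r t (X t \<omega>) w)) (V t \<omega>)"
      by (simp add: score_def r_in)
    then show ?case
      by (simp add: score_error_def grad_ln[OF r_diff])
  qed
  have t': "t \<in> {0..T}" using t by simp
  note identity = implicit_score_identity[OF \<open>prob_space M\<close> distr r0 r_diff r_cont C1_on_slice[OF C1 t'] e_int err
      d_int[unfolded marginal_law_def implicit_score_integrand_def]]
  show "0 < fisher_information (r t)"
    by (rule identity(1))
  show "(\<integral>\<omega>. score_error \<rho> X V s t \<omega> \<partial>M)
      - (\<integral>z. implicit_score_integrand s t z \<partial>marginal_law M X V t) = fisher_information (r t)"
    unfolding marginal_law_def implicit_score_integrand_def by (rule identity(2))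
qed

section \<open>Averaging over time\<close>

lemma integral_uniform_measure_Icc:
  fixes f :: "real \<Rightarrow> real"
  assumes "0 < T" "f \<in> borel_measurable borel"
  shows "(\<integral>t. f t \<partial>uniform_time T) = 1 / T * (LINT t:{0..T}|lborel. f t)"
proof -
  have "(\<lambda>t. indicator {0..T} t / emeasure lborel {0..T}) = (\<lambda>t. ennreal (indicator {0..T} t / T))"
    using assms(1) by (auto simp: fun_eq_iff indicator_def divide_ennreal[symmetric])
  then have "uniform_time T = density lborel (\<lambda>t. ennreal (indicator {0..T} t / T))"
    unfolding uniform_measure_def by simp
  then have "(\<integral>t. f t \<partial>uniform_time T) = (\<integral>t. (indicator {0..T} t / T) *\<^sub>R f t \<partial>lborel)"
    using assms by (simp add: integral_density)
  also have "\<dots> = (\<integral>t. 1 / T * (indicator {0..T} t *\<^sub>R f t) \<partial>lborel)"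
    by simp
  finally show ?thesis
    unfolding set_lebesgue_integral_def by (simp only: integral_mult_right_zero)
qed

theorem proposition4p1:
  fixes G :: "'a::euclidean_space set" and n :: "'a \<Rightarrow> 'a"
    and T \<epsilon> :: real
    and b :: "real \<Rightarrow> 'a \<Rightarrow> 'a" and \<gamma> :: "real \<Rightarrow> real"
    and M :: "'w measure" and F :: "real \<Rightarrow> 'w measure"
    and W X V :: "real \<Rightarrow> 'w \<Rightarrow> 'a"
    and \<rho> :: "real \<Rightarrow> 'a \<Rightarrow> 'a \<Rightarrow> real"
    and \<Theta> :: "'p set" and s :: "'p \<Rightarrow> real \<Rightarrow> 'a \<Rightarrow> 'a \<Rightarrow> 'a"
  assumes "open G" and "bounded G"
    and "0 < \<epsilon>" and "\<epsilon> \<le> 1" and "Holder_boundary 4 \<epsilon> G"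
    and "\<And>x. x \<in> frontier G \<Longrightarrow> outward_unit_normal G x (n x)"
    and "0 < T"
    and "prob_space M"
    and "confined_langevin M F T G n b \<gamma> W X V"
    and "has_marginal_densities M T G X V \<rho>"
    and "fokker_planck_specular T G n b \<gamma> \<rho>"
    and "\<And>\<theta>. \<theta> \<in> \<Theta> \<Longrightarrow> C1_on ({0..T} \<times> UNIV \<times> UNIV) (\<lambda>(t, x, v). s \<theta> t x v)"
    and "\<And>\<theta>. \<theta> \<in> \<Theta> \<Longrightarrow> iterated_expectation_exists T (\<lambda>t. M) (score_error \<rho> X V (s \<theta>))"
    and "\<And>\<theta>. \<theta> \<in> \<Theta> \<Longrightarrow>
           iterated_expectation_exists T (marginal_law M X V) (implicit_score_integrand (s \<theta>))"
  shows "\<exists>C>0. \<forall>\<theta>\<in>\<Theta>.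
           score_matching_loss M T \<rho> X V (s \<theta>) =
             (\<integral>t. (\<integral>z. implicit_score_integrand (s \<theta>) t z \<partial>marginal_law M X V t)
                \<partial>uniform_time T) + C"
proof (cases "\<Theta> = {}")
  case True
  \<comment> \<open>Without a parameter there is no integrability hypothesis from which to form the
    constant; any positive number will do.\<close>
  then show ?thesis by (intro exI[of _ 1]) simp
next
  case False
  then obtain \<theta>\<^sub>0 where \<theta>\<^sub>0: "\<theta>\<^sub>0 \<in> \<Theta>" by blast
  let ?U = "uniform_time T"
  define J where "J t = fisher_information (\<lambda>x v. indicator G x * \<rho> t x v)" for t
  define e where "e \<theta> t = (\<integral>\<omega>. score_error \<rho> X V (s \<theta>) t \<omega> \<partial>M)" for \<theta> t
  define d where "d \<theta> t = (\<integral>z. implicit_score_integrand (s \<theta>) t z \<partial>marginal_law M X V t)" for \<theta> t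
  interpret U: prob_space ?U
    using \<open>0 < T\<close> by (intro prob_space_uniform_measure) auto
  have null: "frontier G \<in> null_sets lborel"
    using \<open>open G\<close> \<open>Holder_boundary 4 \<epsilon> G\<close> null_sets_frontier[of G 3] by (simp add: eval_nat_numeral)
  have e_int: "integrable ?U (e \<theta>)" and d_int: "integrable ?U (d \<theta>)" if "\<theta> \<in> \<Theta>" for \<theta>
    using assms(13,14)[OF that] unfolding iterated_expectation_exists_def e_def d_def by auto
  \<comment> \<open>Marginal densities start after time 0 and the equation is posed on the open
    interval; the two endpoints are a null set.\<close>
  have interior_time: "AE t in ?U. t \<in> {0<..<T}"
    using AE_lborel_singleton[of 0] AE_lborel_singleton[of T]
    by (intro AE_uniform_measureI) (auto elim: eventually_elim2)
  have identity: "AE t in ?U. 0 < J t \<and> e \<theta> t - d \<theta> t = J t" if "\<theta> \<in> \<Theta>" for \<theta>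
  proof -
    have "AE t in ?U. integrable M (score_error \<rho> X V (s \<theta>) t)"
        "AE t in ?U. integrable (marginal_law M X V t) (implicit_score_integrand (s \<theta>) t)"
      using assms(13,14)[OF that] unfolding iterated_expectation_exists_def by auto
    then show ?thesis
      using interior_time
    proof eventually_elim
      case (elim t)
      then show ?case
        using score_error_at_time[OF \<open>open G\<close> null \<open>prob_space M\<close> assms(10,11) assms(12)[OF that] elim(3,1,2)]
        unfolding J_def e_def d_def by blast
    qed
  qed
  \<comment> \<open>This is the time average of \<open>J\<close>, expressed through one fixed
    parameter: measurability and integrability in time are then inherited from the hypotheses on the
    two losses. Almost everywhere the integrand equals \<open>J t\<close>, which does not mention
    the parameter.\<close>
  define C where "C = (\<integral>t. e \<theta>\<^sub>0 t - d \<theta>\<^sub>0 t \<partial>?U)"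
  have C_int: "integrable ?U (\<lambda>t. e \<theta>\<^sub>0 t - d \<theta>\<^sub>0 t)"
    using e_int[OF \<theta>\<^sub>0] d_int[OF \<theta>\<^sub>0] by simp
  have pos: "AE t in ?U. 0 < e \<theta>\<^sub>0 t - d \<theta>\<^sub>0 t"
    using identity[OF \<theta>\<^sub>0] by eventually_elim simp
  have nn: "AE t in ?U. 0 \<le> e \<theta>\<^sub>0 t - d \<theta>\<^sub>0 t"
    using pos by eventually_elim simp
  \<comment> \<open>A zero integral of a nonnegative function would force the strictly positive
    integrand to vanish almost everywhere, which is impossible on a probability space.\<close>
  have "C \<noteq> 0"
  proof
    assume "C = 0"
    then have "AE t in ?U. e \<theta>\<^sub>0 t - d \<theta>\<^sub>0 t = 0"
      using integral_nonneg_eq_0_iff_AE[OF C_int nn] by (simp add: C_def)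
    with pos have "AE t in ?U. False" by eventually_elim simp
    then show False by simp
  qed
  then have "0 < C"
    using integral_nonneg_AE[OF nn] by (simp add: C_def)
  moreover have "score_matching_loss M T \<rho> X V (s \<theta>) = (\<integral>t. d \<theta> t \<partial>?U) + C" if "\<theta> \<in> \<Theta>" for \<theta>
  proof -
    have meas: "e \<theta> \<in> borel_measurable borel"
      using borel_measurable_integrable[OF e_int[OF that]]
      by (simp cong: measurable_cong_sets)
    have "C = (\<integral>t. e \<theta> t - d \<theta> t \<partial>?U)"
      unfolding C_def
    proof (rule integral_cong_AE)
      show "AE t in ?U. e \<theta>\<^sub>0 t - d \<theta>\<^sub>0 t = e \<theta> t - d \<theta> t"
        using identity[OF that] identity[OF \<theta>\<^sub>0] by eventually_elim simp
    qed (use e_int d_int that \<theta>\<^sub>0 in \<open>auto intro!: borel_measurable_diff\<close>)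
    also have "\<dots> = (\<integral>t. e \<theta> t \<partial>?U) - (\<integral>t. d \<theta> t \<partial>?U)"
      using e_int[OF that] d_int[OF that] by (rule Bochner_Integration.integral_diff)
    finally show ?thesis
      using integral_uniform_measure_Icc[OF \<open>0 < T\<close> meas]
      by (simp add: score_matching_loss_def e_def)
  qed
  ultimately show ?thesis
    unfolding d_def by blast
qed

end
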